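(* Let $q$ be a prime power and let $n,k$ be integers with $k\geq 2$ and $n\geq 2k$. Let $r$ be the integer with $r \equiv n \pmod{(k-1)}$ and $0\leq r<k-1$. If $k>\frac{q^r-1}{q-1}+1$, then $$A_q^{*}(n,\{1,2,\ldots,k,n-k+1,\ldots,n-1\})=\frac{q^n-q^{k+r-1}}{q^{k-1}-1}+1.$$
   Context: For integers $0<t_1<\cdots<t_s<n$, a flag of type $(t_1,\ldots,t_s)$ on $\mathbb F_q^n$ is a sequence $\mathcal F=(\mathcal F_1,\ldots,\mathcal F_s)$ of subspaces of $\mathbb F_q^n$ with $\dim\mathcal F_i=t_i$ and $\mathcal F_1\subsetneq\cdots\subsetneq\mathcal F_s$. The subspace distance is $d_S(\mathcal U,\mathcal V)=\dim\mathcal U+\dim\mathcal V-2\dim(\mathcal U\cap\mathcal V)$, and the flag distance is $d_f(\mathcal F,\mathcal F')=\sum_{i=1}^{s}d_S(\mathcal F_i,\mathcal F'_i)$. A flag code of type $(t_1,\ldots,t_s)$ is a nonempty set $\mathcal C$ of flags of this type; its minimum distance $d_f(\mathcal C)$ is the minimum of $d_f(\mathcal F,\mathcal F')$ over distinct $\mathcal F,\mathcal F'\in\mathcal C$. One always has $d_f(\mathcal C)\le d_{\max}$, where $$d_{\max}=2\Big(\sum_{t_i\leq \lfloor n/2\rfloor}t_i+\sum_{t_i> \lfloor n/2\rfloor}(n-t_i)\Big).$$ The code $\mathcal C$ is called an $(n,(t_1,\ldots,t_s))_q$ almost optimum distance flag code (AODFC) if $d_f(\mathcal C)=d_{\max}-2$.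 $A^{*}_q(n,\{t_1,\ldots,t_s\})$ denotes the maximum number of flags in an $(n,(t_1,\ldots,t_s))_q$-AODFC. *)

theory Defs
  imports "HOL-Analysis.Cartesian_Space" "HOL-Number_Theory.Cong"
begin

text \<open>
  The space \<open>F_q^n\<close> is rendered as \<open>'a ^ 'n\<close> for a finite field \<open>'a\<close> with \<open>q = CARD('a)\<close> and a
  finite index type \<open>'n\<close> with \<open>n = CARD('n)\<close>. That \<open>q\<close> is a prime power is implied by the sort
  of \<open>'a\<close>.
\<close>

definition flag_type :: "nat \<Rightarrow> nat list \<Rightarrow> bool" where
  "flag_type n ts \<longleftrightarrow> ts \<noteq> [] \<and> sorted_wrt (<) ts \<and> (\<forall>t \<in> set ts. 0 < t \<and> t < n)"

definition is_flag :: "nat list \<Rightarrow> ('a::field ^ 'n::finite) set list \<Rightarrow> bool" where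
  "is_flag ts F \<longleftrightarrow>
     length F = length ts \<and>
     (\<forall>i < length ts. vec.subspace (F ! i) \<and> vec.dim (F ! i) = ts ! i) \<and>
     sorted_wrt (\<subset>) F"

text \<open>The subtraction on \<^typ>\<open>nat\<close> does not truncate when the arguments are subspaces.\<close>

definition subspace_distance :: "('a::field ^ 'n::finite) set \<Rightarrow> ('a ^ 'n) set \<Rightarrow> nat" where
  "subspace_distance U V = vec.dim U + vec.dim V - 2 * vec.dim (U \<inter> V)"

definition flag_distance ::
    "('a::field ^ 'n::finite) set list \<Rightarrow> ('a ^ 'n) set list \<Rightarrow> nat" where
  "flag_distance F G = (\<Sum>i < length F. subspace_distance (F ! i) (G ! i))"

definition flag_code :: "nat list \<Rightarrow> ('a::field ^ 'n::finite) set list set \<Rightarrow> bool" where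
  "flag_code ts C \<longleftrightarrow> flag_type CARD('n) ts \<and> C \<noteq> {} \<and> (\<forall>F \<in> C. is_flag ts F)"

text \<open>Meaningful only for codes with at least two flags.\<close>

definition code_distance :: "('a::field ^ 'n::finite) set list set \<Rightarrow> nat" where
  "code_distance C = Min {flag_distance F G | F G. F \<in> C \<and> G \<in> C \<and> F \<noteq> G}"

definition max_flag_distance :: "nat \<Rightarrow> nat list \<Rightarrow> nat" where
  "max_flag_distance n ts =
     2 * ((\<Sum>t | t \<in> set ts \<and> t \<le> n div 2. t) + (\<Sum>t | t \<in> set ts \<and> t > n div 2. n - t))"

text \<open>
  The existence of two distinct flags is required because otherwise the minimum distance is
  undefined. The distance condition is written without subtraction.
\<close>

definition aodfc :: "nat list \<Rightarrow> ('a::field ^ 'n::finite) set list set \<Rightarrow> bool" where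
  "aodfc ts C \<longleftrightarrow>
     flag_code ts C \<and> (\<exists>F \<in> C. \<exists>G \<in> C. F \<noteq> G) \<and>
     code_distance C + 2 = max_flag_distance CARD('n) ts"

text \<open>
  The maximum is over a finite set, since \<open>'a ^ 'n\<close> is finite. A type given as a finite set of
  dimensions stands for the increasing sequence of its elements.
\<close>

definition max_aodfc_size :: "'a::{field,finite} itself \<Rightarrow> 'n::finite itself \<Rightarrow> nat set \<Rightarrow> nat" where
  "max_aodfc_size _ _ T =
     Max {card C | C :: ('a ^ 'n) set list set. aodfc (sorted_list_of_set T) C}"

end

theory Submission
  imports Defs "HOL-Algebra.Algebraic_Closure_Type" "HOL-Number_Theory.Residues"
begin

text \<open>
  Put \<open>t = k - 1\<close>. Two distinct flags of an AODFC lose at most 2 against the maximal distance. A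
  nontrivial intersection in dimension \<open>t\<close> would persist in dimension \<open>t + 1\<close> and cost at least 4, so
  the members of dimension \<open>t\<close> form a partial spread, whose size is bounded by the theorem of Nastase
  and Sissokho.

  Conversely, one needs pairwise trivially intersecting \<open>U\<close> of dimension \<open>t\<close> inside \<open>E\<close> of dimension
  \<open>t + 1\<close> inside \<open>W\<close> of dimension \<open>n - t\<close>, where any two \<open>E\<close> meet in dimension at most 1 and any two
  \<open>W\<close> span the space; every other member of the flags then contributes the maximal distance. If \<open>t\<close>
  divides \<open>n\<close>, take the multiples of one such triple in the field of order \<open>q^n\<close>. Otherwise, write
  \<open>V = T \<times> K\<close> with \<open>K\<close> the field of order \<open>q^(n-t)\<close> and \<open>T \<subseteq> K\<close> of dimension \<open>t\<close>, take for each
  nonzero \<open>b\<close> the graph \<open>U\<close> of \<open>x \<mapsto> b x\<close> and the graph \<open>W\<close> of \<open>y \<mapsto> p (y / b)\<close> for a projection \<open>p\<close>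
  onto \<open>T\<close>, and continue inductively in \<open>K\<close>.
\<close>

section \<open>Subfields of the algebraic closure of a finite field\<close>

text \<open>A large partial spread alone does not supply nested E and W that behave well at both
  ends of the flag; making all frames instances of one algebraic pattern does. If E met U' and E'
  met U nontrivially, both the ratio of the two parameters and its inverse would be expressed
  through one auxiliary element \<nu>. Multiplying eliminates the ratio and leaves an equation for
  \<nu>. It is impossible when \<nu> lies outside the field of order q^(2t), respectively when the
  projection p kills \<nu>. In the divisible case such a \<nu> exists because n \<ge> 2t + 2 and t
  dvd n force n \<ge> 3t.

  The constants match because the inductive construction adds q^d frames when the dimension grows
  from d to d + t, a geometric progression whose sum is the upper bound. The hypothesis on k says
  that (q^r - 1) / (q - 1) is less than t, which is what the counting of holes in the upper bound
  needs.

  An AODFC must have distance exactly 2 below the maximum, so some two E must really meet. They do: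
  otherwise the members of dimension t + 1 would contain more nonzero vectors than the space
  has.\<close>

lemma field_power_card_eq_self:
  fixes x :: "'a::{field,finite}"
  shows "x ^ CARD('a) = x"
proof (cases "x = 0")
  case False
  \<comment> \<open>Multiplication by \<open>x\<close> permutes the nonzero elements, so their
    product is unchanged and cancels.\<close>
  have "x * (\<Prod>y\<in>UNIV-{0}. x * y) = x * x ^ (CARD('a) - 1) * \<Prod>(UNIV-{0})"
    by (simp add: prod.distrib mult_ac)
  also have "x * x ^ (CARD('a) - 1) = x ^ Suc (CARD('a) - 1)"
    by (rule power_Suc[symmetric])
  also have "Suc (CARD('a) - 1) = CARD('a)"
    by simp
  also have "(\<Prod>y\<in>UNIV-{0}. x * y) = (\<Prod>y\<in>UNIV-{0}. y)"
    by (rule prod.reindex_bij_witness[of _ "\<lambda>y. y / x" "\<lambda>y. x * y"]) (use False in auto)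
  finally show ?thesis
    by simp
qed simp

lemma card_field_ge_2: "2 \<le> CARD('a::{field,finite})"
proof -
  have "card {0, 1 :: 'a} \<le> CARD('a)"
    by (rule card_mono) auto
  then show ?thesis by simp
qed

lemma to_ac_power_card [simp]: "to_ac (x :: 'a::{field,finite}) ^ CARD('a) = to_ac x"
  using field_power_card_eq_self[of x] by (metis to_ac_power)

text \<open>
  The polynomial \<open>(X + y)^q - X^q - y^q\<close> has degree less than \<open>q\<close>, so it vanishes as soon as it has
  the \<open>q\<close> elements of the base field as roots. This yields additivity of the Frobenius map first for
  \<open>y\<close> in the base field and then for all \<open>y\<close>, without knowing that \<open>q\<close> is a prime power.
\<close>
lemma frobenius_add_aux:
  fixes x y :: "'a::{field,finite} alg_closure"
  assumes "\<And>c. (to_ac c + y) ^ CARD('a) = to_ac c ^ CARD('a) + y ^ CARD('a)"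
  shows "(x + y) ^ CARD('a) = x ^ CARD('a) + y ^ CARD('a)"
proof -
  let ?q = "CARD('a)"
  define R where "R = [:y, 1:] ^ ?q - monom 1 ?q - [:y ^ ?q:]"
  have val: "poly R z = (z + y) ^ ?q - z ^ ?q - y ^ ?q" for z
    by (simp add: R_def poly_monom add.commute)
  have "coeff R ?q = 0"
    by (simp add: R_def coeff_linear_power coeff_eq_0)
  moreover have "Polynomial.degree R \<le> ?q"
    unfolding R_def
    by (intro degree_diff_le order.trans[OF degree_power_le] degree_monom_le) auto
  ultimately have deg: "R \<noteq> 0 \<Longrightarrow> Polynomial.degree R < ?q"
    by (metis leading_coeff_neq_0 le_neq_implies_less)
  have "R = 0"
  proof (rule ccontr)
    assume R0: "R \<noteq> 0"
    have "?q = card (range (to_ac :: 'a \<Rightarrow> _))"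
      by (simp add: card_image inj_to_ac)
    also have "\<dots> \<le> card {z. poly R z = 0}"
      using assms by (intro card_mono poly_roots_finite R0) (auto simp: val)
    also have "\<dots> \<le> Polynomial.degree R"
      by (rule card_poly_roots_bound[OF R0])
    finally show False
      using deg[OF R0] by simp
  qed
  then show ?thesis
    using val[of x] by (simp add: algebra_simps)
qed

lemma frobenius_add:
  fixes x y :: "'a::{field,finite} alg_closure"
  shows "(x + y) ^ CARD('a) = x ^ CARD('a) + y ^ CARD('a)"
proof (rule frobenius_add_aux)
  fix c :: 'a
  have "(y + to_ac c) ^ CARD('a) = y ^ CARD('a) + to_ac c ^ CARD('a)"
    by (rule frobenius_add_aux) (simp flip: to_ac_add)
  then show "(to_ac c + y) ^ CARD('a) = to_ac c ^ CARD('a) + y ^ CARD('a)"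
    by (simp add: add.commute)
qed

lemma frobenius_pow_add:
  fixes x y :: "'a::{field,finite} alg_closure"
  shows "(x + y) ^ (CARD('a) ^ d) = x ^ (CARD('a) ^ d) + y ^ (CARD('a) ^ d)"
  by (induction d) (simp_all add: frobenius_add power_mult mult.commute[of "CARD('a)"])

lemma frobenius_pow_minus:
  fixes x :: "'a::{field,finite} alg_closure"
  shows "(- x) ^ (CARD('a) ^ d) = - (x ^ (CARD('a) ^ d))"
  using frobenius_pow_add[of x "- x" d] by (simp add: eq_neg_iff_add_eq_0 power_0_left add.commute)

lemma frobenius_pow_sum:
  fixes f :: "'b \<Rightarrow> 'a::{field,finite} alg_closure"
  shows "(\<Sum>i\<in>I. f i) ^ (CARD('a) ^ d) = (\<Sum>i\<in>I. f i ^ (CARD('a) ^ d))"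
  by (induction I rule: infinite_finite_induct) (simp_all add: frobenius_pow_add)

text \<open>The subfield of order \<open>q^d\<close> of the algebraic closure of a field of order \<open>q\<close>, for \<open>d > 0\<close>.\<close>
definition gf :: "nat \<Rightarrow> 'a::{field,finite} alg_closure set" where
  "gf d = {x. x ^ (CARD('a) ^ d) = x}"

lemma gf_0 [simp]: "0 \<in> gf d"
  and gf_1 [simp]: "1 \<in> gf d"
  by (simp_all add: gf_def)

lemma gf_add: "x \<in> gf d \<Longrightarrow> y \<in> gf d \<Longrightarrow> x + y \<in> gf d"
  and gf_minus: "x \<in> gf d \<Longrightarrow> - x \<in> gf d"
  and gf_mult: "x \<in> gf d \<Longrightarrow> y \<in> gf d \<Longrightarrow> x * y \<in> gf d"
  and gf_inverse: "x \<in> gf d \<Longrightarrow> inverse x \<in> gf d"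
  by (simp_all add: gf_def frobenius_pow_add frobenius_pow_minus power_mult_distrib power_inverse)

lemma gf_diff: "x \<in> gf d \<Longrightarrow> y \<in> gf d \<Longrightarrow> x - y \<in> gf d"
  using gf_add[of x d "- y"] gf_minus[of y d] by simp

lemma gf_divide: "x \<in> gf d \<Longrightarrow> y \<in> gf d \<Longrightarrow> x / y \<in> gf d"
  by (simp add: divide_inverse gf_mult gf_inverse)

lemma to_ac_power_card_power [simp]: "to_ac (x :: 'a::{field,finite}) ^ (CARD('a) ^ d) = to_ac x"
  by (induction d) (simp_all add: power_mult)

lemma to_ac_in_gf [simp]: "to_ac c \<in> gf d"
  by (simp add: gf_def)

lemmas gf_closed = gf_add gf_minus gf_mult gf_inverse gf_diff gf_divide

lemma gf_mono:
  assumes "d dvd n"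
  shows "gf d \<subseteq> (gf n :: 'a::{field,finite} alg_closure set)"
proof
  fix x :: "'a alg_closure"
  assume x: "x \<in> gf d"
  obtain m where n: "n = d * m" using assms by blast
  have "x ^ ((CARD('a) ^ d) ^ m) = x"
    using x by (induction m) (simp_all add: gf_def power_mult)
  then show "x \<in> gf n"
    by (simp add: gf_def n power_mult)
qed

text \<open>The polynomial X^N - X with N = q^d splits over the closure, and its derivative is -1
  because the characteristic divides N. A double root would be a root of the derivative, so there
  are N distinct roots.\<close>

lemma card_gf:
  assumes "d > 0"
  shows "card (gf d :: 'a::{field,finite} alg_closure set) = CARD('a) ^ d"
proof -
  let ?N = "CARD('a) ^ d"
  have N2: "2 \<le> ?N"
    using card_field_ge_2[where 'a='a] assms
    by (metis order.trans self_le_power le_trans one_le_numeral)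
  define p :: "'a alg_closure poly" where "p = monom 1 ?N - monom 1 1"
  have val: "poly p x = x ^ ?N - x" for x
    by (simp add: p_def poly_monom)
  have deg: "Polynomial.degree p = ?N"
    unfolding p_def using N2
    by (subst diff_conv_add_uminus, subst degree_add_eq_left) (auto simp: degree_monom_eq)
  have p0: "p \<noteq> 0" using deg N2 by auto
  have "of_nat ?N = (0 :: 'a alg_closure)"
  proof -
    have "CHAR('a) dvd ?N"
      using CHAR_dvd_CARD[where 'a='a] assms by (simp add: dvd_power_same dvd_trans dvd_power)
    then show ?thesis
      by (simp add: of_nat_eq_0_iff_char_dvd del: of_nat_power)
  qed
  then have pd: "pderiv p = - 1"
    by (simp add: p_def pderiv_diff pderiv_monom monom_0 one_pCons del: of_nat_power)
  obtain A where A: "size A = Polynomial.degree p"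
    "p = Polynomial.smult (lead_coeff p) (\<Prod>x\<in>#A. [:-x, 1:])"
    using alg_closed_imp_factorization[OF p0] by blast
  have "count A a \<le> 1" for a
  proof (rule ccontr)
    assume "\<not> ?thesis"
    then have "{#a, a#} \<subseteq># A"
      by (auto simp: subseteq_mset_def)
    then obtain C where "A = {#a, a#} + C"
      by (auto simp: subset_mset.le_iff_add)
    then have "p = [:-a, 1:] * ([:-a, 1:] *
        Polynomial.smult (lead_coeff p) (\<Prod>x\<in>#C. [:-x, 1:]))"
      by (subst A(2)) (simp add: mult_ac)
    then obtain s where s: "p = [:-a, 1:] * ([:-a, 1:] * s)"
      by blast
    have "poly (pderiv p) a = 0"
      by (simp add: s pderiv_mult del: mult_pCons_left mult_pCons_right)
    then show False by (simp add: pd)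
  qed
  then have "size A = card (set_mset A)"
    by (simp add: size_multiset_overloaded_eq)
       (metis (no_types, lifting) One_nat_def count_greater_eq_one_iff le_antisym card_eq_sum sum.cong)
  moreover have "set_mset A = gf d"
  proof -
    have "x \<in># A \<longleftrightarrow> x \<in> gf d" for x
    proof -
      have "x \<in> gf d \<longleftrightarrow> poly p x = 0"
        by (simp add: val gf_def)
      also have "\<dots> \<longleftrightarrow> x \<in># A"
        using p0 by (subst A(2)) (auto simp: poly_prod_mset prod_mset_zero_iff)
      finally show ?thesis by simp
    qed
    then show ?thesis by blast
  qed
  ultimately show ?thesis
    using A(1) deg by simp
qed

lemma finite_gf [simp]:
  assumes "d > 0"
  shows "finite (gf d :: 'a::{field,finite} alg_closure set)"
proof (rule card_ge_0_finite)
  show "card (gf d :: 'a alg_closure set) > 0"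
    by (simp add: card_gf[OF assms])
qed

section \<open>Linear algebra over finite fields\<close>

lemma card_span_independent:
  fixes s :: "'a::{field,finite} \<Rightarrow> 'b::ab_group_add \<Rightarrow> 'b"
  assumes "vector_space s" "finite B" "\<not> module.dependent s B"
  shows "card (module.span s B) = CARD('a) ^ card B" "finite (module.span s B)"
proof -
  interpret vector_space s by fact
  have "finite (span B) \<and> card (span B) = CARD('a) ^ card B"
    using assms(2,3)
  proof (induction B rule: finite_induct)
    case (insert b B)
    have ind: "independent B" and b: "b \<notin> span B"
      using insert.prems insert.hyps by (auto simp: independent_insert)
    note IH = insert.IH[OF ind]
    have eq: "span (insert b B) = (\<lambda>(c, x). s c b + x) ` (UNIV \<times> span B)"
    proof (intro equalityI subsetI)
      fix x assume "x \<in> span (insert b B)"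
      then obtain c where "x - s c b \<in> span B"
        by (auto simp: span_insert)
      then show "x \<in> (\<lambda>(c, x). s c b + x) ` (UNIV \<times> span B)"
        by (intro image_eqI[of _ _ "(c, x - s c b)"]) auto
    next
      fix x assume "x \<in> (\<lambda>(c, x). s c b + x) ` (UNIV \<times> span B)"
      then obtain c y where "x = s c b + y" "y \<in> span B"
        by auto
      then show "x \<in> span (insert b B)"
        by (auto simp: span_insert intro!: exI[of _ c])
    qed
    have "inj_on (\<lambda>(c, x). s c b + x) (UNIV \<times> span B)"
    proof (rule inj_onI, clarify)
      fix c x c' x'
      assume x: "x \<in> span B" "x' \<in> span B" and e: "s c b + x = s c' b + x'"
      have "s (c - c') b = x' - x"
        using e by (simp add: scale_left_diff_distrib algebra_simps)
      then have *: "s (c - c') b \<in> span B"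
        using x by (simp add: span_diff)
      have "c = c'"
      proof (rule ccontr)
        assume "c \<noteq> c'"
        then have "b = s (inverse (c - c')) (s (c - c') b)" by simp
        then show False using b * span_scale by metis
      qed
      then show "c = c' \<and> x = x'" using e by simp
    qed
    then have "card (span (insert b B)) = CARD('a) * card (span B)"
      by (simp add: eq card_image card_cartesian_product)
    then show ?case
      using IH insert.hyps by (simp add: eq)
  qed simp
  then show "card (span B) = CARD('a) ^ card B" "finite (span B)"
    by simp_all
qed

lemma finite_subspace_basis:
  fixes s :: "'a::{field,finite} \<Rightarrow> 'b::ab_group_add \<Rightarrow> 'b"
  assumes "vector_space s" "module.subspace s S" "finite S"
  obtains B where "B \<subseteq> S" "finite B" "\<not> module.dependent s B" "module.span s B = S"
    "card S = CARD('a) ^ card B"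
proof -
  interpret vector_space s by fact
  obtain B where B: "B \<subseteq> S" "independent B" "S \<subseteq> span B"
    using maximal_independent_subset by blast
  then have "span B = S"
    using assms(2) by (simp add: span_minimal subset_antisym)
  then show thesis
    using that[OF B(1) _ B(2)] card_span_independent[OF assms(1) _ B(2)] B(1) assms(3)
    by (metis finite_subset)
qed

lemma card_field_power_inject [simp]:
  "CARD('a::{field,finite}) ^ i = CARD('a) ^ j \<longleftrightarrow> i = j"
  using card_field_ge_2[where 'a='a] by (intro power_inject_exp) simp

text \<open>The scalar multiplications are parameters because the spaces live on different types: a
  subspace of \<open>'a ^ 'n\<close> will be identified with a subfield of the closure or with a set
  of pairs of its elements.\<close>

lemma exists_linear_bij_betw:
  fixes s1 :: "'a::{field,finite} \<Rightarrow> 'b::ab_group_add \<Rightarrow> 'b"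
    and s2 :: "'a \<Rightarrow> 'c::ab_group_add \<Rightarrow> 'c"
  assumes v: "vector_space s1" "vector_space s2"
    and sub: "module.subspace s1 S" "module.subspace s2 T"
    and fin: "finite S" "finite T" and card: "card S = card T"
  obtains f where "Vector_Spaces.linear s1 s2 f" "bij_betw f S T"
proof -
  interpret vector_space_pair s1 s2
    using v by (simp add: vector_space_pair_def)
  obtain B where B: "B \<subseteq> S" "finite B" "vs1.independent B" "vs1.span B = S"
    "card S = CARD('a) ^ card B"
    using finite_subspace_basis[OF v(1) sub(1) fin(1)] .
  obtain C where C: "C \<subseteq> T" "finite C" "vs2.independent C" "vs2.span C = T"
    "card T = CARD('a) ^ card C"
    using finite_subspace_basis[OF v(2) sub(2) fin(2)] .
  have "card B = card C"
    using B(5) C(5) card by simp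
  then obtain h where h: "bij_betw h B C"
    using B(2) C(2) finite_same_card_bij by blast
  obtain f where f: "Vector_Spaces.linear s1 s2 f" "\<forall>x\<in>B. f x = h x"
    using linear_independent_extend[OF B(3)] by blast
  have "f ` B = C"
    using f(2) h by (auto simp: bij_betw_def)
  then have "f ` S = T"
    using linear_span_image[OF f(1), of B] B(4) C(4) by simp
  then have "bij_betw f S T"
    using card fin by (simp add: bij_betw_def eq_card_imp_inj_on)
  then show thesis
    using that f(1) by blast
qed

lemma exists_subspace_card:
  fixes s :: "'a::{field,finite} \<Rightarrow> 'b::ab_group_add \<Rightarrow> 'b"
  assumes "vector_space s" "module.subspace s S" "finite S" "card S = CARD('a) ^ d" "t \<le> d"
  obtains T where "T \<subseteq> S" "module.subspace s T" "card T = CARD('a) ^ t"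
proof -
  interpret vector_space s by fact
  obtain B where B: "B \<subseteq> S" "finite B" "independent B" "span B = S"
    "card S = CARD('a) ^ card B"
    using finite_subspace_basis[OF assms(1-3)] .
  then have "t \<le> card B" using assms by simp
  then obtain C where C: "C \<subseteq> B" "card C = t" "finite C"
    using obtain_subset_with_card_n by metis
  show thesis
  proof
    show "span C \<subseteq> S"
      using span_mono[OF C(1)] B(4) by simp
    show "card (span C) = CARD('a) ^ t"
      using card_span_independent(1)[OF assms(1) C(3)] C(1,2) B(3) independent_mono by blast
  qed simp
qed

lemma exists_linear_projection:
  assumes "vector_space s" "module.subspace s T"
  obtains p where "Vector_Spaces.linear s s p" "range p = T" "\<And>x. x \<in> T \<Longrightarrow> p x = x"
proof -
  interpret vector_space_pair s s
    using assms(1) by (simp add: vector_space_pair_def)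
  obtain B where B: "B \<subseteq> T" "vs1.independent B" "T \<subseteq> vs1.span B"
    using vs1.maximal_independent_subset by blast
  then have span: "vs1.span B = T"
    using assms(2) by (simp add: vs1.span_minimal subset_antisym)
  obtain p where p: "Vector_Spaces.linear s s p" "\<forall>x\<in>B. p x = x" "range p = vs1.span ((\<lambda>x. x) ` B)"
    using linear_independent_extend_subspace[OF B(2), of "\<lambda>x. x"] by blast
  have "Vector_Spaces.linear s s (\<lambda>x. x)"
    by (rule vs1.linear_ident)
  then have "p x = x" if "x \<in> T" for x
    using linear_eq_on[OF p(1), of "\<lambda>x. x" x B] that p(2) span by blast
  then show thesis
    using that p(1,3) span by simp
qed

lemma card_vec_subspace:
  fixes S :: "('a::{field,finite} ^ 'n::finite) set"
  assumes "vec.subspace S"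
  shows "card S = CARD('a) ^ vec.dim S"
proof -
  obtain B where B: "B \<subseteq> S" "finite B" "vec.independent B" "vec.span B = S"
    "card S = CARD('a) ^ card B"
    using finite_subspace_basis[OF vec.vector_space_axioms assms finite] .
  then show ?thesis
    by (metis vec.dim_span_eq_card_independent)
qed

lemma vec_dim_eqI:
  fixes S :: "('a::{field,finite} ^ 'n::finite) set"
  assumes "vec.subspace S" "card S = CARD('a) ^ k"
  shows "vec.dim S = k"
  using card_vec_subspace[OF assms(1)] assms(2) by simp

interpretation ac: vector_space "\<lambda>c (x :: 'a::field alg_closure). to_ac c * x"
  by unfold_locales (simp_all add: algebra_simps)

lemma ac_subspace_gf: "ac.subspace (gf d)"
  by (rule ac.subspaceI) (simp_all add: gf_closed)

section \<open>The size of partial spreads\<close>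

definition dot :: "'a::field ^ 'n::finite \<Rightarrow> 'a ^ 'n \<Rightarrow> 'a" where
  "dot a x = (\<Sum>i\<in>UNIV. a $ i * x $ i)"

lemma dot_add_left: "dot (a + b) x = dot a x + dot b x"
  and dot_add_right: "dot a (x + y) = dot a x + dot a y"
  and dot_diff_right: "dot a (x - y) = dot a x - dot a y"
  and dot_scale_left: "dot (c *s a) x = c * dot a x"
  and dot_scale_right: "dot a (c *s x) = c * dot a x"
  by (simp_all add: dot_def algebra_simps sum.distrib sum_subtractf sum_distrib_left)

lemma dot_axis: "dot (axis i 1) x = x $ i"
  by (simp add: dot_def axis_def if_distrib[of "\<lambda>z. z * _"] cong: if_cong)

lemma subspace_dot_kernel: "vec.subspace {x. dot a x = 0}"
  by (rule vec.subspaceI) (simp_all add: dot_add_right dot_scale_right, simp add: dot_def)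

text \<open>If \<open>y $ i\<close> is nonzero, the multiples of the i-th unit vector shift the
  kernel to q disjoint translates, told apart by the value of \<open>dot _ y\<close>.\<close>

lemma card_dot_kernel_left:
  fixes y :: "'a::{field,finite} ^ 'n::finite"
  assumes "y \<noteq> 0"
  shows "CARD('a) * card {a. dot a y = 0} \<le> CARD('a ^ 'n)"
proof -
  obtain i where i: "y $ i \<noteq> 0"
    using assms by (metis vec_eq_iff zero_index)
  have "inj_on (\<lambda>(c, a). a + c *s axis i 1) (UNIV \<times> {a. dot a y = 0})"
  proof (rule inj_onI, clarify)
    fix c a c' a'
    assume a: "dot a y = 0" "dot a' y = 0" and e: "a + c *s axis i 1 = a' + c' *s axis i 1"
    have "dot (a + c *s axis i 1) y = dot (a' + c' *s axis i 1) y"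
      by (simp add: e)
    then have "c = c'"
      using a i by (simp add: dot_add_left dot_scale_left dot_axis)
    then show "c = c' \<and> a = a'"
      using e by simp
  qed
  then have "card (UNIV \<times> {a. dot a y = 0} :: ('a \<times> ('a ^ 'n)) set) \<le> CARD('a ^ 'n)"
    by (intro card_inj_on_le[of "\<lambda>(c, a). a + c *s axis i 1"]) auto
  then show ?thesis
    by (simp add: card_cartesian_product)
qed

text \<open>A nonzero vector lies in at most a fraction 1/q of the kernels, so the average over all
  \<open>a\<close> yields a good one. The average includes \<open>a = 0\<close>, and for empty
  \<open>Y\<close> the kernel may be the whole space; hence dimensions of sections are only bounded
  from below.\<close>

lemma exists_sparse_hyperplane:
  fixes Y :: "('a::{field,finite} ^ 'n::finite) set"
  assumes "0 \<notin> Y"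
  obtains a where "CARD('a) * card {y \<in> Y. dot a y = 0} \<le> card Y"
proof (rule ccontr)
  assume "\<not> thesis"
  then have gt: "card Y < CARD('a) * card {y \<in> Y. dot a y = 0}" for a
    using that by (meson not_le_imp_less)
  have "card Y * CARD('a ^ 'n) = (\<Sum>a\<in>(UNIV :: ('a ^ 'n) set). card Y)"
    by simp
  also have "\<dots> < (\<Sum>a\<in>UNIV. CARD('a) * card {y \<in> Y. dot a y = 0})"
    by (rule sum_strict_mono) (use gt in auto)
  also have "\<dots> = CARD('a) * (\<Sum>a\<in>UNIV. \<Sum>y\<in>Y. if dot a y = 0 then 1 else 0)"
    by (simp add: sum_distrib_left flip: sum.inter_filter card_eq_sum)
  also have "\<dots> = CARD('a) * (\<Sum>y\<in>Y. card {a. dot a y = 0})"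
    by (subst sum.swap) (simp flip: sum.inter_filter card_eq_sum)
  also have "\<dots> = (\<Sum>y\<in>Y. CARD('a) * card {a. dot a y = 0})"
    by (simp add: sum_distrib_left)
  also have "\<dots> \<le> (\<Sum>y\<in>Y. CARD('a ^ 'n))"
    by (rule sum_mono) (metis assms card_dot_kernel_left)
  finally show False by simp
qed

text \<open>The q fibres of \<open>dot a\<close> cover \<open>S\<close>, and each nonempty one is a
  translate of the kernel.\<close>

lemma dim_Int_dot_kernel:
  fixes S :: "('a::{field,finite} ^ 'n::finite) set"
  assumes S: "vec.subspace S"
  shows "vec.dim S \<le> Suc (vec.dim (S \<inter> {x. dot a x = 0}))"
proof -
  let ?K = "S \<inter> {x. dot a x = 0}"
  have fibre: "card {x \<in> S. dot a x = c} \<le> card ?K" for c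
  proof (cases "\<exists>x0\<in>S. dot a x0 = c")
    case True
    then obtain x0 where x0: "x0 \<in> S" "dot a x0 = c" by blast
    show ?thesis
      by (rule card_inj_on_le[of "\<lambda>x. x - x0"])
         (use x0 S in \<open>auto simp: inj_on_def dot_diff_right vec.subspace_diff\<close>)
  next
    case False
    then have "{x \<in> S. dot a x = c} = {}" by blast
    then show ?thesis by (simp only: card.empty zero_le)
  qed
  have "S = (\<Union>c. {x \<in> S. dot a x = c})" by blast
  then have "card S \<le> (\<Sum>c\<in>(UNIV :: 'a set). card {x \<in> S. dot a x = c})"
    by (metis card_UN_le finite)
  also have "\<dots> \<le> (\<Sum>c\<in>(UNIV :: 'a set). card ?K)"
    by (rule sum_mono) (rule fibre)
  also have "\<dots> = CARD('a) * card ?K" by simp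
  also have "\<dots> = CARD('a) ^ Suc (vec.dim ?K)"
    by (subst card_vec_subspace) (auto intro: vec.subspace_inter S subspace_dot_kernel)
  finally have "CARD('a) ^ vec.dim S \<le> CARD('a) ^ Suc (vec.dim ?K)"
    by (simp add: card_vec_subspace[OF S])
  then show ?thesis
    using card_field_ge_2[where 'a='a] by (subst (asm) power_increasing_iff) auto
qed

lemma card_nonzero_Union:
  fixes P :: "('a::{field,finite} ^ 'n::finite) set set"
  assumes "\<And>U. U \<in> P \<Longrightarrow> vec.subspace U" "pairwise (\<lambda>U W. U \<inter> W \<subseteq> {0}) P"
  shows "int (card (S \<inter> (\<Union>P - {0}))) = (\<Sum>U\<in>P. int (card (S \<inter> (U - {0}))))"
proof -
  have "S \<inter> (\<Union>P - {0}) = (\<Union>U\<in>P. S \<inter> (U - {0}))" by blast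
  moreover have "card (\<Union>U\<in>P. S \<inter> (U - {0})) = (\<Sum>U\<in>P. card (S \<inter> (U - {0})))"
    using assms(2) by (intro card_UN_disjoint) (auto simp: pairwise_def)
  ultimately show ?thesis by simp
qed

lemma card_Int_minus_zero:
  fixes S U :: "('a::{field,finite} ^ 'n::finite) set"
  assumes "vec.subspace U" "vec.subspace S"
  shows "int (card (S \<inter> (U - {0}))) = int CARD('a) ^ vec.dim (S \<inter> U) - 1"
proof -
  have sub: "vec.subspace (S \<inter> U)"
    using assms by (simp add: vec.subspace_inter)
  have "S \<inter> (U - {0}) = (S \<inter> U) - {0}" by blast
  moreover have "card (S \<inter> U) > 0"
    using vec.subspace_0[OF sub] by (auto simp: card_gt_0_iff)
  ultimately show ?thesis
    using vec.subspace_0[OF sub] by (simp add: card_Diff_singleton of_nat_diff Suc_le_eq card_vec_subspace[OF sub])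
qed

text \<open>
  The argument of Nastase and Sissokho: assume there were one more subspace. The vectors that are not
  covered (the holes) inside a subspace of codimension at most \<open>j\<close> have a number of the form
  \<open>A (q - 1) q^(t-j) - q^(t-j) + 1\<close>. Passing to a hyperplane with at most the average number of holes
  lowers \<open>A\<close>, which starts at \<open>\<theta> = (q^r - 1) / (q - 1)\<close>; for \<open>j = \<theta> < t\<close> the number would be negative.
\<close>
lemma partial_spread_card_le:
  fixes P :: "('a::{field,finite} ^ 'n::finite) set set"
  assumes P: "\<And>U. U \<in> P \<Longrightarrow> vec.subspace U" "\<And>U. U \<in> P \<Longrightarrow> vec.dim U = t"
    and disj: "pairwise (\<lambda>U W. U \<inter> W \<subseteq> {0}) P"
    and \<theta>: "\<theta> < t" "\<theta> * (CARD('a) - 1) + 1 = CARD('a) ^ r"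
    and M: "M * (CARD('a) ^ t - 1) + CARD('a) ^ (t + r) + 1 = CARD('a) ^ CARD('n) + CARD('a) ^ t"
  shows "card P \<le> M"
proof (rule ccontr)
  assume "\<not> card P \<le> M"
  then obtain Q where Q: "Q \<subseteq> P" "card Q = Suc M"
    using obtain_subset_with_card_n[of "Suc M" P] by (metis not_less_eq_eq)
  have subQ: "vec.subspace U" "vec.dim U = t" if "U \<in> Q" for U
    using that P Q(1) by auto
  have disjQ: "pairwise (\<lambda>U W. U \<inter> W \<subseteq> {0}) Q"
    using disj Q(1) pairwise_subset by blast
  define q where "q = int CARD('a)"
  have q2: "q \<ge> 2" using card_field_ge_2[where 'a='a] by (simp add: q_def)
  obtain U0 where U0: "U0 \<in> Q" using Q(2) by fastforce
  have tn: "t \<le> CARD('n)"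
    using subQ[OF U0] vec.dim_subset_UNIV[of U0] by (simp add: vec.dimension_def card_cart_basis)
  define H where "H S = S - \<Union>Q" for S
  have H_card: "int (card (H S)) = q ^ vec.dim S - 1 - (\<Sum>U\<in>Q. q ^ vec.dim (S \<inter> U) - 1)"
    if S: "vec.subspace S" for S
  proof -
    have 0: "0 \<in> U0" "0 \<in> S" using subQ(1)[OF U0] S vec.subspace_0 by auto
    then have "H S = S \<inter> (UNIV - {0}) - S \<inter> (\<Union>Q - {0})"
      using U0 by (auto simp: H_def)
    then have "int (card (H S)) = int (card (S \<inter> (UNIV - {0}))) - int (card (S \<inter> (\<Union>Q - {0})))"
      by (subst of_nat_diff[symmetric]) (auto intro!: card_mono card_Diff_subset)
    also have "int (card (S \<inter> (UNIV - {0}))) = q ^ vec.dim S - 1"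
      using card_Int_minus_zero[OF vec.subspace_UNIV S] by (simp add: q_def)
    also have "int (card (S \<inter> (\<Union>Q - {0}))) = (\<Sum>U\<in>Q. q ^ vec.dim (S \<inter> U) - 1)"
      using card_nonzero_Union[OF subQ(1) disjQ] card_Int_minus_zero[OF subQ(1) S]
      by (simp add: q_def)
    finally show ?thesis .
  qed
  have M': "int M * (q ^ t - 1) + q ^ (t + r) + 1 = q ^ CARD('n) + q ^ t"
    using arg_cong[OF M, of int] by (simp add: q_def of_nat_diff)
  have \<theta>': "int \<theta> * (q - 1) + 1 = q ^ r"
    using arg_cong[OF \<theta>(2), of int] by (simp add: q_def of_nat_diff Suc_le_eq)
  \<comment> \<open>Modulo q^t the equation for M reads 1 - M = 0, because t \<le> n.\<close>
  have M_mod: "q ^ t dvd int M - 1"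
  proof -
    have "int M - 1 = q ^ t * (int M + q ^ r - 1) - q ^ CARD('n)"
      using M' by (simp add: algebra_simps power_add)
    then show ?thesis using tn by (simp add: le_imp_power_dvd)
  qed
  have step: "\<exists>S A. vec.subspace S \<and> CARD('n) \<le> vec.dim S + j \<and> (\<forall>U\<in>Q. t \<le> vec.dim (S \<inter> U) + j) \<and>
      int (card (H S)) = A * (q - 1) * q ^ (t - j) - q ^ (t - j) + 1 \<and> A \<le> int \<theta> - int j"
    if "j \<le> t" for j
    using that
  proof (induction j)
    case 0
    \<comment> \<open>With M + 1 members the terms q^n cancel and q^(t+r) - 2 q^t + 1 holes remain;
      q^r - 1 = \<theta> (q - 1) turns this into the required form.\<close>
    have "int (card (H UNIV)) = q ^ CARD('n) - 1 - (int M + 1) * (q ^ t - 1)"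
      using H_card[OF vec.subspace_UNIV] subQ(2) Q(2) by (simp add: card_cart_basis)
    also have "\<dots> = q ^ (t + r) - 2 * q ^ t + 1"
      using M' by (simp add: algebra_simps)
    also have "\<dots> = int \<theta> * (q - 1) * q ^ t - q ^ t + 1"
      by (simp add: power_add flip: \<theta>') (simp add: algebra_simps)
    finally show ?case
      using subQ by (intro exI[of _ UNIV] exI[of _ "int \<theta>"]) (simp add: card_cart_basis)
  next
    case (Suc j)
    then obtain S A where S: "vec.subspace S" "CARD('n) \<le> vec.dim S + j"
      "\<And>U. U \<in> Q \<Longrightarrow> t \<le> vec.dim (S \<inter> U) + j"
      and A: "int (card (H S)) = A * (q - 1) * q ^ (t - j) - q ^ (t - j) + 1" "A \<le> int \<theta> - int j"
      by auto
    have "0 \<notin> H S" using U0 subQ(1)[OF U0] vec.subspace_0 by (auto simp: H_def)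
    then obtain a where a: "CARD('a) * card {y \<in> H S. dot a y = 0} \<le> card (H S)"
      using exists_sparse_hyperplane by blast
    define T where "T = S \<inter> {x. dot a x = 0}"
    have T: "vec.subspace T"
      unfolding T_def by (intro vec.subspace_inter S(1) subspace_dot_kernel)
    have dT: "CARD('n) \<le> vec.dim T + Suc j"
      using dim_Int_dot_kernel[OF S(1), of a] S(2) by (simp add: T_def)
    have dTU: "t \<le> vec.dim (T \<inter> U) + Suc j" if U: "U \<in> Q" for U
    proof -
      have "T \<inter> U = (S \<inter> U) \<inter> {x. dot a x = 0}" by (auto simp: T_def)
      then show ?thesis
        using dim_Int_dot_kernel[of "S \<inter> U" a] S(3)[OF U] vec.subspace_inter[OF S(1) subQ(1)[OF U]]
        by simp
    qed
    define e where "e = t - Suc j"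
    have te: "t - j = Suc e" using Suc.prems by (simp add: e_def)
    \<comment> \<open>\<open>T\<close> and its intersections with the members of \<open>Q\<close>
      have dimension at least \<open>e\<close>, so modulo q^e the number of holes is M, that is,
      1.\<close>
    have "q ^ e dvd int (card (H T)) - 1"
    proof -
      have eq: "int (card (H T)) - 1 =
          q ^ vec.dim T - (\<Sum>U\<in>Q. q ^ vec.dim (T \<inter> U)) + (int M - 1)"
        using H_card[OF T] Q(2) by (simp add: sum_subtractf)
      have "q ^ e dvd q ^ vec.dim T"
        using dT tn by (intro le_imp_power_dvd) (simp add: e_def)
      moreover have "q ^ e dvd q ^ vec.dim (T \<inter> U)" if "U \<in> Q" for U
        using dTU[OF that] by (intro le_imp_power_dvd) (simp add: e_def)
      moreover have "q ^ e dvd int M - 1"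
        using M_mod by (rule dvd_trans[rotated]) (simp add: e_def le_imp_power_dvd)
      ultimately show ?thesis
        unfolding eq by (intro dvd_add[OF dvd_diff[OF _ dvd_sum]])
    qed
    then have "q ^ e dvd int (card (H T)) - 1 + q ^ e" by simp
    \<comment> \<open>Powers of q are 1 modulo q - 1, so q - 1 divides the number of holes. As it is
      coprime to q^e, the two congruences combine into the same form with a new coefficient
      \<open>B\<close>.\<close>
    moreover have q1: "q - 1 dvd q ^ i - 1" for i
      using power_diff_1_eq[of q i] by simp
    have "q - 1 dvd int (card (H T)) + (q ^ e - 1)"
      unfolding H_card[OF T] by (intro dvd_add dvd_diff dvd_sum q1)
    then have "q - 1 dvd int (card (H T)) - 1 + q ^ e" by (simp add: algebra_simps)
    moreover have "coprime (q - 1) (q ^ e)"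
      by (simp add: coprime_diff_one_left)
    ultimately have "(q - 1) * q ^ e dvd int (card (H T)) - 1 + q ^ e"
      by (simp add: divides_mult)
    then obtain B where B: "int (card (H T)) - 1 + q ^ e = (q - 1) * q ^ e * B"
      by blast
    have "{y \<in> H S. dot a y = 0} = H T" by (auto simp: H_def T_def)
    then have "q * int (card (H T)) \<le> int (card (H S))"
      using a by (simp add: q_def flip: of_nat_mult)
    moreover define Z where "Z = (q - 1) * q ^ Suc e"
    moreover have "q * int (card (H T)) = B * Z - q ^ Suc e + q"
      using arg_cong[OF B, of "\<lambda>x. q * x"] by (simp add: Z_def algebra_simps)
    moreover have "int (card (H S)) = A * Z - q ^ Suc e + 1"
      using A(1) unfolding te Z_def by (simp only: mult.assoc)
    \<comment> \<open>The constant term is q on the left and 1 on the right of the averaging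
      inequality. This surplus makes the inequality between the coefficients strict, so each section
      lowers \<open>A\<close> by at least one.\<close>
    ultimately have "B * Z < A * Z"
      using q2 by linarith
    moreover have "Z > 0"
      using q2 by (simp add: Z_def)
    ultimately have "B < A"
      by (simp add: mult_less_cancel_right)
    moreover have "int (card (H T)) = B * (q - 1) * q ^ e - q ^ e + 1"
      using B by (simp add: algebra_simps)
    ultimately show ?case
      using T dT dTU A(2) by (intro exI[of _ T] exI[of _ B]) (auto simp: e_def)
  qed
  obtain S A where "int (card (H S)) = A * (q - 1) * q ^ (t - \<theta>) - q ^ (t - \<theta>) + 1" "A \<le> 0"
    using step[of \<theta>] \<theta>(1) by auto
  moreover have "A * (q - 1) * q ^ (t - \<theta>) \<le> 0"
    using \<open>A \<le> 0\<close> q2 by (simp add: mult_nonpos_nonneg)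
  moreover have "q ^ 1 \<le> q ^ (t - \<theta>)"
    using \<theta>(1) q2 by (intro power_increasing) auto
  ultimately show False
    using q2 by simp
qed

section \<open>Families of frames\<close>

definition subspace_sum :: "'b::plus set \<Rightarrow> 'b set \<Rightarrow> 'b set" where
  "subspace_sum S T = {x + y | x y. x \<in> S \<and> y \<in> T}"

lemma subspace_sumI: "x \<in> S \<Longrightarrow> y \<in> T \<Longrightarrow> x + y \<in> subspace_sum S T"
  by (auto simp: subspace_sum_def)

lemma subspace_sumI_diff:
  fixes v :: "'b::ab_group_add"
  shows "x \<in> S \<Longrightarrow> v - x \<in> T \<Longrightarrow> v \<in> subspace_sum S T"
  using subspace_sumI[of x S "v - x" T] by simp

lemma subspace_sum_commute: "subspace_sum S T = subspace_sum T (S :: 'b::ab_semigroup_add set)"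
  by (auto simp: subspace_sum_def) (metis add.commute)+

lemma subspace_sum_mono: "S \<subseteq> S' \<Longrightarrow> T \<subseteq> T' \<Longrightarrow> subspace_sum S T \<subseteq> subspace_sum S' T'"
  by (auto simp: subspace_sum_def)

lemma subspace_subspace_sum: "vec.subspace S \<Longrightarrow> vec.subspace T \<Longrightarrow> vec.subspace (subspace_sum S T)"
  unfolding subspace_sum_def by (rule vec.subspace_sums)

lemma subset_subspace_sum:
  assumes "vec.subspace S" "vec.subspace T"
  shows "S \<subseteq> subspace_sum S T" "T \<subseteq> subspace_sum S T"
  using subspace_sumI[OF _ vec.subspace_0[OF assms(2)]] subspace_sumI[OF vec.subspace_0[OF assms(1)]]
  by fastforce+

lemma subspace_sum_subset:
  "vec.subspace V \<Longrightarrow> S \<subseteq> V \<Longrightarrow> T \<subseteq> V \<Longrightarrow> subspace_sum S T \<subseteq> V"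
  by (auto simp: subspace_sum_def vec.subspace_add subset_iff)

lemma dim_subspace_sum_Int:
  fixes S T :: "('a::field ^ 'n::finite) set"
  assumes "vec.subspace S" "vec.subspace T"
  shows "vec.dim (subspace_sum S T) + vec.dim (S \<inter> T) = vec.dim S + vec.dim T"
  unfolding subspace_sum_def using vec.dim_sums_Int[OF assms] .

lemma dim_subspace_sum:
  fixes S T :: "('a::field ^ 'n::finite) set"
  assumes "vec.subspace S" "vec.subspace T" "S \<inter> T \<subseteq> {0}"
  shows "vec.dim (subspace_sum S T) = vec.dim S + vec.dim T"
proof -
  have "vec.dim (S \<inter> T) = 0"
    using assms(3) vec.dim_eq_0 by blast
  then show ?thesis using dim_subspace_sum_Int[OF assms(1,2)] by linarith
qed

type_synonym ('a, 'n) frame = "('a ^ 'n) set \<times> ('a ^ 'n) set \<times> ('a ^ 'n) set"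

text \<open>
  A frame consists of the members of dimensions \<open>t\<close>, \<open>t + 1\<close> and \<open>n - t\<close> of a flag; the remaining
  members do not affect the distance to other flags.
\<close>
definition frame :: "nat \<Rightarrow> ('a::field ^ 'n::finite) set \<Rightarrow> ('a, 'n) frame \<Rightarrow> bool" where
  "frame t V = (\<lambda>(U, E, W). vec.subspace U \<and> vec.subspace E \<and> vec.subspace W \<and>
     vec.dim U = t \<and> vec.dim E = Suc t \<and> vec.dim W + t = vec.dim V \<and> U \<subseteq> E \<and> E \<subseteq> W \<and> W \<subseteq> V)"

text \<open>
  The first condition forces \<open>U \<inter> U' = 0\<close> and \<open>dim (E \<inter> E') \<le> 1\<close>, but is easier to propagate.
\<close>
definition compatible :: "('a::field ^ 'n::finite) set \<Rightarrow> ('a, 'n) frame \<Rightarrow> ('a, 'n) frame \<Rightarrow> bool" where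
  "compatible V = (\<lambda>(U, E, W) (U', E', W').
     (E \<inter> U' \<subseteq> {0} \<or> E' \<inter> U \<subseteq> {0}) \<and> V \<subseteq> subspace_sum W W')"

definition frame_family :: "nat \<Rightarrow> ('a::field ^ 'n::finite) set \<Rightarrow> ('a, 'n) frame set \<Rightarrow> bool" where
  "frame_family t V \<F> \<longleftrightarrow> (\<forall>F\<in>\<F>. frame t V F) \<and> pairwise (compatible V) \<F>"

lemma compatible_sym: "compatible V F G \<Longrightarrow> compatible V G F"
  by (auto simp: compatible_def subspace_sum_commute split: prod.splits)

text \<open>A frame is not compatible with itself, since U \<subseteq> E would force U to be zero.
  This provides injectivity and disjointness whenever families are counted.\<close>

lemma compatible_imp_neq:
  assumes "frame t V F" "frame t V G" "compatible V F G" "t > 0"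
  shows "F \<noteq> G"
proof -
  obtain U E W U' E' W' where FG: "F = (U, E, W)" "G = (U', E', W')"
    by (cases F, cases G) auto
  have "\<not> U \<subseteq> {0}"
    using assms(1,4) FG by (auto simp: frame_def simp del: subset_singleton_iff dest!: vec.dim_eq_0[THEN iffD2])
  then have "U \<noteq> U'"
    using assms(1-3) FG unfolding frame_def compatible_def by blast
  then show "F \<noteq> G" by (simp add: FG)
qed

lemma frame_family_image:
  fixes F :: "'i \<Rightarrow> ('a::{field,finite}, 'n::finite) frame"
  assumes "t > 0" "\<And>i. i \<in> I \<Longrightarrow> frame t V (F i)"
    and "\<And>i j. i \<in> I \<Longrightarrow> j \<in> I \<Longrightarrow> i \<noteq> j \<Longrightarrow> compatible V (F i) (F j)"
  shows "frame_family t V (F ` I)" "card (F ` I) = card I"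
proof -
  show "frame_family t V (F ` I)"
    using assms(2,3) by (force simp: frame_family_def pairwise_def)
  have "inj_on F I"
    using assms compatible_imp_neq by (metis inj_onI)
  then show "card (F ` I) = card I"
    by (rule card_image)
qed

lemma frame_family_Un:
  fixes \<F> \<G> :: "('a::{field,finite}, 'n::finite) frame set"
  assumes "t > 0" "frame_family t V \<F>" "frame_family t V \<G>"
    and cross: "\<And>F G. F \<in> \<F> \<Longrightarrow> G \<in> \<G> \<Longrightarrow> compatible V F G"
  shows "frame_family t V (\<F> \<union> \<G>)" "card (\<F> \<union> \<G>) = card \<F> + card \<G>"
proof -
  show "frame_family t V (\<F> \<union> \<G>)"
    using assms(2,3) cross compatible_sym[OF cross]
    unfolding frame_family_def pairwise_def by (metis Un_iff)
  have "\<F> \<inter> \<G> = {}"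
    using assms(1-3) cross compatible_imp_neq unfolding frame_family_def by blast
  then show "card (\<F> \<union> \<G>) = card \<F> + card \<G>"
    by (intro card_Un_disjoint) auto
qed

lemma frame_family_insert:
  fixes \<F> :: "('a::{field,finite}, 'n::finite) frame set"
  assumes "t > 0" "frame_family t V \<F>" "frame t V F" "\<And>G. G \<in> \<F> \<Longrightarrow> compatible V F G"
  shows "frame_family t V (insert F \<F>)" "card (insert F \<F>) = Suc (card \<F>)"
  using frame_family_Un[of t V "{F}" \<F>] assms by (auto simp: frame_family_def)

section \<open>Recursive construction of frame families from a field of order q^d\<close>

text \<open>
  A space \<open>V\<close> of dimension \<open>d + t\<close>, written as \<open>K \<times> T\<close> with \<open>K\<close> the field of order \<open>q^d\<close> and \<open>T\<close> a
  subspace of \<open>K\<close> of dimension \<open>t\<close>. The maps \<open>f\<close> and \<open>g\<close> are the two coordinates and \<open>p\<close> projects onto \<open>T\<close>.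
\<close>
locale field_coordinates =
  fixes V :: "('a::{field,finite} ^ 'n::finite) set" and d t :: nat
    and f g :: "'a ^ 'n \<Rightarrow> 'a alg_closure" and T :: "'a alg_closure set"
    and p :: "'a alg_closure \<Rightarrow> 'a alg_closure" and \<nu> :: "'a alg_closure"
  assumes V: "vec.subspace V" and t_pos: "0 < t" and t_less: "t < d"
    and f_add: "f (x + y) = f x + f y" and f_scale: "f (c *s x) = to_ac c * f x"
    and g_add: "g (x + y) = g x + g y" and g_scale: "g (c *s x) = to_ac c * g x"
    and p_add: "p (a + b) = p a + p b" and p_scale: "p (to_ac c * a) = to_ac c * p a"
    and bij: "bij_betw (\<lambda>v. (f v, g v)) V (gf d \<times> T)"
    and T: "T \<subseteq> gf d" "card T = CARD('a) ^ t"
    and p_T: "p a \<in> T" and p_id: "a \<in> T \<Longrightarrow> p a = a"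
    and \<nu>: "\<nu> \<in> gf d" "\<nu> \<noteq> 0" "p \<nu> = 0"
begin

definition "U b = {v \<in> V. f v = b * g v}"
text \<open>For nonzero \<open>b\<close> this gains one dimension over \<open>U b\<close> and still
  lies in \<open>W b\<close>: since \<open>p\<close> kills \<nu>, a multiple of \<nu> added to
  \<open>g v\<close> does not change the projection.\<close>

definition "E b = {v \<in> V. \<exists>c. f v = b * (g v + to_ac c * \<nu>)}"
definition "W b = {v \<in> V. g v = p (f v / b)}"
definition "ker_g = {v \<in> V. g v = 0}"
definition "ker_f = {v \<in> V. f v = 0}"

lemma p_0: "p 0 = 0" using p_add[of 0 0] by (metis add_0 add_cancel_right_right)
lemma f_0: "f 0 = 0" using f_add[of 0 0] by (metis add_0 add_cancel_right_right)
lemma g_0: "g 0 = 0" using g_add[of 0 0] by (metis add_0 add_cancel_right_right)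
lemma p_diff: "p (a - b) = p a - p b" using p_add[of "a - b" b] by simp
lemma f_diff: "f (x - y) = f x - f y" using f_add[of "x - y" y] by simp
lemma g_diff: "g (x - y) = g x - g y" using g_add[of "x - y" y] by simp
lemma zero_T: "0 \<in> T" using p_T[of 0] p_0 by simp
lemma p_g: "v \<in> V \<Longrightarrow> p (g v) = g v" using bij p_id by (auto simp: bij_betw_def)
lemma f_in: "v \<in> V \<Longrightarrow> f v \<in> gf d" and g_in: "v \<in> V \<Longrightarrow> g v \<in> T"
  using bij by (auto simp: bij_betw_def)

lemma p_scale_\<nu>: "p (to_ac c * \<nu>) = 0"
  by (simp add: p_scale \<nu>)

lemma coordinates_eqI: "v \<in> V \<Longrightarrow> w \<in> V \<Longrightarrow> f v = f w \<Longrightarrow> g v = g w \<Longrightarrow> v = w"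
  using bij by (auto simp: bij_betw_def inj_on_def)

lemma obtain_coordinates:
  assumes "y \<in> gf d" "b \<in> T"
  obtains v where "v \<in> V" "f v = y" "g v = b"
proof -
  have "(y, b) \<in> (\<lambda>v. (f v, g v)) ` V"
    using bij assms by (simp add: bij_betw_def)
  then show thesis using that by auto
qed

lemma subspaces:
  "vec.subspace (U b)" "vec.subspace (E b)" "vec.subspace (W b)" "vec.subspace ker_g" "vec.subspace ker_f"
proof -
  note lin = f_0 g_0 p_0 f_add g_add p_add f_scale g_scale p_scale V vec.subspace_0 vec.subspace_add
    vec.subspace_scale
  show "vec.subspace (U b)" "vec.subspace ker_g" "vec.subspace ker_f"
    by (auto intro!: vec.subspaceI simp: U_def ker_g_def ker_f_def lin algebra_simps)
  show "vec.subspace (W b)"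
    by (rule vec.subspaceI)
       (auto simp: W_def lin add_divide_distrib simp flip: p_scale times_divide_eq_right)
  show "vec.subspace (E b)"
  proof (rule vec.subspaceI)
    show "0 \<in> E b"
      by (auto simp: E_def lin intro!: exI[of _ 0])
  next
    fix x y assume "x \<in> E b" "y \<in> E b"
    then obtain c c' where "f x = b * (g x + to_ac c * \<nu>)" "f y = b * (g y + to_ac c' * \<nu>)"
      "x \<in> V" "y \<in> V" by (auto simp: E_def)
    then show "x + y \<in> E b"
      by (auto simp: E_def lin algebra_simps intro!: exI[of _ "c + c'"])
  next
    fix k x assume "x \<in> E b"
    then obtain c where "f x = b * (g x + to_ac c * \<nu>)" "x \<in> V" by (auto simp: E_def)
    then show "k *s x \<in> E b"
      by (auto simp: E_def lin algebra_simps intro!: exI[of _ "k * c"])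
  qed
qed

lemma U_subset_E: "U b \<subseteq> E b"
  by (auto simp: U_def E_def intro!: exI[of _ 0])

lemma E_subset_W:
  assumes "b \<noteq> 0"
  shows "E b \<subseteq> W b"
  using assms by (auto simp: E_def W_def p_add p_scale_\<nu> p_g)

lemma dim_U:
  assumes "b \<in> gf d"
  shows "vec.dim (U b) = t"
proof (rule vec_dim_eqI[OF subspaces(1)])
  have "bij_betw g (U b) T"
  proof (rule bij_betw_imageI)
    show "inj_on g (U b)"
      by (auto simp: inj_on_def U_def intro: coordinates_eqI)
    show "g ` U b = T"
    proof (intro equalityI subsetI)
      fix a assume a: "a \<in> T"
      then obtain v where "v \<in> V" "f v = b * a" "g v = a"
        using obtain_coordinates assms T(1) gf_mult by (metis subsetD)
      then show "a \<in> g ` U b" by (auto simp: U_def)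
    qed (auto simp: U_def g_in)
  qed
  then show "card (U b) = CARD('a) ^ t"
    using T(2) bij_betw_same_card by metis
qed

text \<open>The map \<open>f v / b\<close> is a bijection from \<open>E b\<close> to the sum of
  \<open>T\<close> and the line of \<nu>. That sum is direct because \<open>p\<close> fixes
  \<open>T\<close> and kills \<nu>.\<close>

lemma dim_E:
  assumes b: "b \<in> gf d" "b \<noteq> 0"
  shows "vec.dim (E b) = Suc t"
proof (rule vec_dim_eqI[OF subspaces(2)])
  let ?S = "(\<lambda>(a, c). a + to_ac c * \<nu>) ` (T \<times> UNIV)"
  have "bij_betw (\<lambda>v. f v / b) (E b) ?S"
  proof (rule bij_betw_imageI)
    show "inj_on (\<lambda>v. f v / b) (E b)"
    proof (rule inj_onI)
      fix v w assume vw: "v \<in> E b" "w \<in> E b" and eq: "f v / b = f w / b"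
      have "g v = p (f v / b)" "g w = p (f w / b)" "v \<in> V" "w \<in> V"
        using vw E_subset_W[OF b(2)] by (auto simp: W_def)
      then show "v = w"
        using eq b(2) by (auto intro: coordinates_eqI)
    qed
    show "(\<lambda>v. f v / b) ` E b = ?S"
    proof (intro equalityI subsetI)
      fix z assume "z \<in> (\<lambda>v. f v / b) ` E b"
      then obtain v where "v \<in> E b" "z = f v / b" by blast
      moreover from this obtain c where "v \<in> V" "f v = b * (g v + to_ac c * \<nu>)"
        by (auto simp: E_def)
      ultimately show "z \<in> ?S"
        using b(2) g_in by (intro image_eqI[of _ _ "(g v, c)"]) auto
    next
      fix z assume "z \<in> ?S"
      then obtain a c where a: "a \<in> T" "z = a + to_ac c * \<nu>" by auto
      then have "b * z \<in> gf d"
        using T(1) \<nu>(1) b(1) by (auto intro!: gf_closed)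
      then obtain v where "v \<in> V" "f v = b * z" "g v = a"
        using obtain_coordinates a(1) by metis
      then show "z \<in> (\<lambda>v. f v / b) ` E b"
        using a b(2) by (intro image_eqI[of _ _ v]) (auto simp: E_def)
    qed
  qed
  moreover have "inj_on (\<lambda>(a, c). a + to_ac c * \<nu>) (T \<times> UNIV)"
  proof (rule inj_onI, clarify)
    fix a c a' c'
    assume a: "a \<in> T" "a' \<in> T" and eq: "a + to_ac c * \<nu> = a' + to_ac c' * \<nu>"
    have "p (a + to_ac c * \<nu>) = p (a' + to_ac c' * \<nu>)" using eq by simp
    then have "a = a'"
      using a by (simp add: p_add p_scale_\<nu> p_id)
    then show "a = a' \<and> c = c'" using eq \<nu>(2) by simp
  qed
  ultimately show "card (E b) = CARD('a) ^ Suc t"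
    using T(2) by (simp add: bij_betw_same_card card_image card_cartesian_product)
qed

lemma dim_W:
  assumes b: "b \<in> gf d" "b \<noteq> 0"
  shows "vec.dim (W b) = d"
proof (rule vec_dim_eqI[OF subspaces(3)])
  have "bij_betw f (W b) (gf d)"
  proof (rule bij_betw_imageI)
    show "inj_on f (W b)"
      by (auto simp: inj_on_def W_def intro: coordinates_eqI)
    show "f ` W b = gf d"
    proof (intro equalityI subsetI)
      fix y :: "'a alg_closure" assume y: "y \<in> gf d"
      then obtain v where "v \<in> V" "f v = y" "g v = p (y / b)"
        using obtain_coordinates p_T by metis
      then show "y \<in> f ` W b" by (auto simp: W_def)
    qed (auto simp: W_def f_in)
  qed
  then show "card (W b) = CARD('a) ^ d"
    using card_gf[of d] t_less bij_betw_same_card by force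
qed

lemma dim_V: "vec.dim V = d + t"
proof (rule vec_dim_eqI[OF V])
  show "card V = CARD('a) ^ (d + t)"
    using bij_betw_same_card[OF bij] t_less T(2)
    by (simp add: card_cartesian_product card_gf power_add)
qed

lemma dim_ker_g: "vec.dim ker_g = d"
proof (rule vec_dim_eqI[OF subspaces(4)])
  have "bij_betw f ker_g (gf d)"
  proof (rule bij_betw_imageI)
    show "inj_on f ker_g"
      by (auto simp: inj_on_def ker_g_def intro: coordinates_eqI)
    show "f ` ker_g = gf d"
    proof (intro equalityI subsetI)
      fix y :: "'a alg_closure" assume "y \<in> gf d"
      then obtain v where "v \<in> V" "f v = y" "g v = 0"
        using obtain_coordinates zero_T by metis
      then show "y \<in> f ` ker_g" by (auto simp: ker_g_def)
    qed (auto simp: ker_g_def f_in)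
  qed
  then show "card ker_g = CARD('a) ^ d"
    using card_gf[of d] t_less bij_betw_same_card by force
qed

lemma U_0: "U 0 = ker_f"
  by (simp add: U_def ker_f_def)

lemma dim_ker_f: "vec.dim ker_f = t"
  using dim_U[of 0] by (simp add: U_0)

lemma ker_f_Int_ker_g: "ker_f \<inter> ker_g \<subseteq> {0}"
  using coordinates_eqI[OF _ vec.subspace_0[OF V]] by (auto simp: ker_f_def ker_g_def f_0 g_0)

lemma ker_sum: "V \<subseteq> subspace_sum ker_f ker_g"
proof
  fix v assume v: "v \<in> V"
  then obtain w where "w \<in> V" "f w = 0" "g w = g v"
    using obtain_coordinates[OF gf_0 g_in] by metis
  then show "v \<in> subspace_sum ker_f ker_g"
    using v V by (intro subspace_sumI_diff[of w]) (auto simp: ker_f_def ker_g_def g_diff vec.subspace_diff)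
qed

lemma ker_f_W_sum:
  assumes b: "b \<in> gf d" "b \<noteq> 0"
  shows "V \<subseteq> subspace_sum ker_f (W b)"
proof
  fix v assume v: "v \<in> V"
  then obtain w where w: "w \<in> V" "f w = f v" "g w = p (f v / b)"
    using obtain_coordinates[OF f_in p_T] by metis
  then have "w + (v - w) \<in> subspace_sum (W b) ker_f"
    using v V by (intro subspace_sumI) (auto simp: W_def ker_f_def f_diff vec.subspace_diff)
  then show "v \<in> subspace_sum ker_f (W b)" by (simp add: subspace_sum_commute)
qed

lemma ker_g_W_sum:
  assumes b: "b \<in> gf d" "b \<noteq> 0"
  shows "V \<subseteq> subspace_sum ker_g (W b)"
proof
  fix v assume v: "v \<in> V"
  have "b * g v \<in> gf d" using v g_in T(1) b(1) by (auto intro: gf_mult)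
  then obtain w where w: "w \<in> V" "f w = b * g v" "g w = g v"
    using obtain_coordinates g_in[OF v] by metis
  then have "w + (v - w) \<in> subspace_sum (W b) ker_g"
    using v V b(2) by (intro subspace_sumI) (auto simp: W_def ker_g_def g_diff vec.subspace_diff p_g)
  then show "v \<in> subspace_sum ker_g (W b)" by (simp add: subspace_sum_commute)
qed

text \<open>\<open>W b\<close> and \<open>W b'\<close> are graphs over the coordinate
  \<open>f\<close>. The difference of the two maps is z \<mapsto> p (s z) with s = 1/b - 1/b'
  nonzero, which is onto \<open>T\<close>.\<close>

lemma W_sum:
  assumes b: "b \<in> gf d" "b \<noteq> 0" "b' \<in> gf d" "b' \<noteq> 0" "b \<noteq> b'"
  shows "V \<subseteq> subspace_sum (W b) (W b')"
proof
  fix v assume v: "v \<in> V"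
  define s where "s = 1 / b - 1 / b'"
  have s: "s \<in> gf d" "s \<noteq> 0"
    using b by (auto simp: s_def intro!: gf_closed gf_1)
  define a where "a = g v - p (f v / b')"
  have pa: "p a = a"
    using p_id[OF p_T] p_g[OF v] by (simp add: a_def p_diff)
  then have "a \<in> T" using p_T[of a] by simp
  then have "a / s \<in> gf d" using s T(1) by (auto intro: gf_divide)
  \<comment> \<open>Membership of \<open>v - w\<close> in \<open>W b'\<close> amounts to p (s * f w)
    = a; since \<open>p\<close> fixes \<open>a\<close>, the quotient \<open>a / s\<close> solves
    it.\<close>
  then obtain w where w: "w \<in> V" "f w = a / s" "g w = p (a / s / b)"
    using obtain_coordinates p_T by metis
  have "a / s / b - a / s / b' = a / s * (1 / b - 1 / b')" by (simp add: right_diff_distrib)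
  also have "\<dots> = a" unfolding s_def[symmetric] using s(2) by simp
  finally have "p (a / s / b) - p (a / s / b') = a"
    by (simp only: p_diff[symmetric] pa)
  then have "g v - p (a / s / b) = p (f v / b') - p (a / s / b')"
    by (simp add: a_def algebra_simps)
  then show "v \<in> subspace_sum (W b) (W b')"
    using v w V
    by (intro subspace_sumI_diff[of w])
       (auto simp: W_def g_diff f_diff diff_divide_distrib p_diff vec.subspace_diff)
qed

text \<open>Nonzero vectors in both intersections give b' x = b (x + c \<nu>) and b y = b' (y + c'
  \<nu>) with x, y nonzero in \<open>T\<close>. Multiplying cancels b b', and dividing by \<nu>
  leaves c' x + c y + c c' \<nu> = 0. Applying \<open>p\<close> removes the last term, so c c' \<nu>
  = 0, although c and c' are nonzero by b \<noteq> b'.\<close>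

lemma E_U_Int:
  assumes b: "b \<noteq> 0" "b' \<noteq> 0" "b \<noteq> b'"
  shows "E b \<inter> U b' \<subseteq> {0} \<or> E b' \<inter> U b \<subseteq> {0}"
proof (rule ccontr)
  assume "\<not> ?thesis"
  then obtain v w where v: "v \<in> E b" "v \<in> U b'" "v \<noteq> 0" and w: "w \<in> E b'" "w \<in> U b" "w \<noteq> 0"
    by blast
  obtain c where c: "f v = b * (g v + to_ac c * \<nu>)" using v(1) by (auto simp: E_def)
  obtain c' where c': "f w = b' * (g w + to_ac c' * \<nu>)" using w(1) by (auto simp: E_def)
  define x y where "x = g v" and "y = g w"
  have V': "v \<in> V" "w \<in> V" and fv: "f v = b' * x" and fw: "f w = b * y"
    using v w by (auto simp: U_def x_def y_def)
  have x: "x \<noteq> 0" and y: "y \<noteq> 0"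
    using coordinates_eqI[OF V'(1) vec.subspace_0[OF V]] coordinates_eqI[OF V'(2) vec.subspace_0[OF V]]
      v(3) w(3) fv fw by (auto simp: f_0 g_0 x_def y_def)
  have pxy: "p x = x" "p y = y"
    using V' by (auto simp: x_def y_def p_g)
  have e1: "b' * x = b * (x + to_ac c * \<nu>)" and e2: "b * y = b' * (y + to_ac c' * \<nu>)"
    using c c' fv fw by (simp_all add: x_def y_def)
  have cc: "c \<noteq> 0" "c' \<noteq> 0"
    using e1 e2 b x y by auto
  have "(b * b') * (x * y) = (b' * x) * (b * y)" by (simp add: mult_ac)
  also have "\<dots> = (b * b') * ((x + to_ac c * \<nu>) * (y + to_ac c' * \<nu>))"
    unfolding e1 e2 by (simp add: mult_ac)
  finally have "x * y = (x + to_ac c * \<nu>) * (y + to_ac c' * \<nu>)" using b by simp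
  then have "\<nu> * (to_ac c' * x + to_ac c * y + to_ac (c * c') * \<nu>) = 0"
    by (simp add: algebra_simps)
  then have z: "to_ac c' * x + to_ac c * y + to_ac (c * c') * \<nu> = 0"
    using \<nu>(2) by simp
  then have "p (to_ac c' * x + to_ac c * y + to_ac (c * c') * \<nu>) = 0" by (simp only: p_0)
  then have "to_ac c' * x + to_ac c * y = 0"
    by (simp only: p_add p_scale pxy \<nu>(3)) simp
  then have "to_ac (c * c') * \<nu> = 0" using z by simp
  then show False using \<nu>(2) cc by simp
qed

lemma frame_main:
  "b \<in> gf d \<Longrightarrow> b \<noteq> 0 \<Longrightarrow> frame t V (U b, E b, W b)"
  by (simp add: frame_def subspaces dim_U dim_E dim_W dim_V U_subset_E E_subset_W) (auto simp: W_def)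

lemma ker_g_Int_U: "ker_g \<inter> U b \<subseteq> {0}"
  using coordinates_eqI[OF _ vec.subspace_0[OF V]] by (auto simp: U_def ker_g_def f_0 g_0)

lemma E_Int_ker_f:
  assumes "b \<noteq> 0"
  shows "E b \<inter> ker_f \<subseteq> {0}"
proof
  fix v assume v: "v \<in> E b \<inter> ker_f"
  then obtain c where "v \<in> V" "g v + to_ac c * \<nu> = 0" and f: "f v = 0"
    using assms by (auto simp: E_def ker_f_def)
  then have "p (g v + to_ac c * \<nu>) = 0" by (simp only: p_0)
  then have "g v = 0" using \<open>v \<in> V\<close> by (simp add: p_add p_g p_scale_\<nu>)
  then show "v \<in> {0}"
    using f \<open>v \<in> V\<close> coordinates_eqI[OF _ vec.subspace_0[OF V]] by (simp add: f_0 g_0)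
qed

text \<open>
  The subspaces of \<open>ker_g\<close> are paired with the sums of \<open>ker_f\<close> and subspaces of \<open>ker_g\<close>, except
  that \<open>ker_f\<close> itself takes the partner of \<open>U1\<close>, which in turn takes \<open>ker_g\<close>. Hence \<open>U1 \<subseteq> W1\<close> is not
  needed, which makes the case of a single subspace \<open>U1\<close> available as the base of the induction.
\<close>
lemma extend:
  assumes \<G>: "frame_family t ker_g \<G>"
    and sub1: "vec.subspace U1" "vec.subspace E1" "vec.subspace W1"
    and dim1: "vec.dim U1 = t" "vec.dim E1 = Suc t" "vec.dim W1 + t = d" "vec.dim W1 > 0"
    and incl1: "U1 \<subseteq> E1" "E1 \<subseteq> ker_g" "W1 \<subseteq> ker_g"
    and comp1: "\<And>F. F \<in> \<G> \<Longrightarrow> compatible ker_g (U1, E1, W1) F"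
  shows "\<exists>\<F>. frame_family t V \<F> \<and> card \<F> = CARD('a) ^ d + card \<G> + 1"
proof -
  note kf = subspaces(5) and kg = subspaces(4)
  have kV: "ker_f \<subseteq> V" "ker_g \<subseteq> V" by (auto simp: ker_f_def ker_g_def)
  \<comment> \<open>Adding \<open>ker_f\<close>, of dimension t, restores codimension t of the third
    member when passing from \<open>ker_g\<close> to \<open>V\<close>.\<close>
  define lift where "lift = (\<lambda>(Y :: ('a ^ 'n) set, Z :: ('a ^ 'n) set, S). (Y, Z, subspace_sum ker_f S))"
  have dim_lift: "vec.dim (subspace_sum ker_f S) = t + vec.dim S" if "vec.subspace S" "S \<subseteq> ker_g" for S
    using that ker_f_Int_ker_g dim_ker_f by (subst dim_subspace_sum[OF kf]) auto
  have lift_sum: "V \<subseteq> subspace_sum (subspace_sum ker_f S) (subspace_sum ker_f S')"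
    if S: "vec.subspace S" "vec.subspace S'" "ker_g \<subseteq> subspace_sum S S'" for S S'
  proof
    fix v assume "v \<in> V"
    then obtain x y where "x \<in> ker_f" "y \<in> ker_g" "v = x + y"
      using ker_sum by (auto simp: subspace_sum_def)
    moreover from this obtain s s' where "s \<in> S" "s' \<in> S'" "y = s + s'"
      using S by (auto simp: subspace_sum_def)
    ultimately have "v = (x + s) + (0 + s')" "x + s \<in> subspace_sum ker_f S"
      "0 + s' \<in> subspace_sum ker_f S'"
      using subspace_sumI vec.subspace_0[OF kf] by (simp add: add.assoc, blast+)
    then show "v \<in> subspace_sum (subspace_sum ker_f S) (subspace_sum ker_f S')"
      using subspace_sumI by metis
  qed
  have \<G>_D: "vec.subspace Y" "vec.subspace Z" "vec.subspace S" "vec.dim Y = t" "vec.dim Z = Suc t"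
    "vec.dim S + t = d" "Y \<subseteq> Z" "Z \<subseteq> S" "S \<subseteq> ker_g" if "(Y, Z, S) \<in> \<G>" for Y Z S
    using \<G> that dim_ker_g by (auto simp: frame_family_def frame_def)
  have kf_sum: "V \<subseteq> subspace_sum (subspace_sum ker_f S) (W b)"
    if "vec.subspace S" "b \<in> gf d" "b \<noteq> 0" for S b
    using ker_f_W_sum[OF that(2,3)] subset_subspace_sum(1)[OF kf that(1)]
      subspace_sum_mono[of ker_f "subspace_sum ker_f S"] by blast
  have kf_sum': "V \<subseteq> subspace_sum (subspace_sum ker_f S) ker_g" if "vec.subspace S" for S
    using ker_sum subset_subspace_sum(1)[OF kf that] subspace_sum_mono[of ker_f "subspace_sum ker_f S"] by blast

  define \<A> where "\<A> = (\<lambda>b. (U b, E b, W b)) ` (gf d - {0})"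
  have \<A>_frame: "frame t V (U b, E b, W b)" if "b \<in> gf d - {0}" for b
    using that frame_main by simp
  have \<A>_comp: "compatible V (U b, E b, W b) (U b', E b', W b')"
    if "b \<in> gf d - {0}" "b' \<in> gf d - {0}" "b \<noteq> b'" for b b'
    using that E_U_Int[of b b'] W_sum[of b b'] by (simp add: compatible_def)
  note \<A> = frame_family_image[where I = "gf d - {0}" and F = "\<lambda>b. (U b, E b, W b)",
      OF t_pos \<A>_frame \<A>_comp, folded \<A>_def]

  have \<B>_frame: "frame t V (lift F)" if "F \<in> \<G>" for F
  proof -
    obtain Y Z S where F: "F = (Y, Z, S)" by (cases F)
    note D = \<G>_D[OF that[unfolded F]]
    show ?thesis
      using D dim_lift[OF D(3,9)] dim_V kV subset_subspace_sum(2)[OF kf D(3)]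
        subspace_sum_subset[OF V kV(1), of S]
      by (auto simp: F lift_def frame_def subspace_subspace_sum kf)
  qed
  have \<B>_comp: "compatible V (lift F) (lift F')" if F: "F \<in> \<G>" "F' \<in> \<G>" "F \<noteq> F'" for F F'
  proof -
    obtain Y Z S Y' Z' S' where eq: "F = (Y, Z, S)" "F' = (Y', Z', S')"
      by (cases F, cases F')
    have "compatible ker_g F F'"
      using \<G> F unfolding frame_family_def pairwise_def by blast
    then show ?thesis
      using lift_sum[OF \<G>_D(3)[OF F(1)[unfolded eq]] \<G>_D(3)[OF F(2)[unfolded eq]]]
      by (simp add: eq lift_def compatible_def)
  qed
  note \<B> = frame_family_image[where I = \<G> and F = lift, OF t_pos \<B>_frame \<B>_comp]
  have \<A>\<B>: "compatible V F G" if "F \<in> \<A>" "G \<in> lift ` \<G>" for F G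
  proof -
    obtain b Y Z S where b: "F = (U b, E b, W b)" "b \<in> gf d" "b \<noteq> 0" "G = lift (Y, Z, S)" "(Y, Z, S) \<in> \<G>"
      using \<open>F \<in> \<A>\<close> \<open>G \<in> lift ` \<G>\<close> by (auto simp: \<A>_def)
    note D = \<G>_D[OF b(5)]
    have "Z \<inter> U b \<subseteq> {0}" using ker_g_Int_U D by blast
    then show ?thesis
      using b kf_sum[OF D(3) b(2,3)] by (simp add: compatible_def lift_def subspace_sum_commute[of "W b"])
  qed
  note \<A>\<B>_family = frame_family_Un[OF t_pos \<A>(1) \<B>(1) \<A>\<B>]

  have fr1: "frame t V (U1, E1, ker_g)"
    using sub1 dim1 incl1 kV kg dim_ker_g dim_V by (simp add: frame_def)
  have "compatible V (U1, E1, ker_g) G" if G: "G \<in> \<A> \<union> lift ` \<G>" for G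
    using G
  proof
    assume "G \<in> \<A>"
    then obtain b where b: "b \<in> gf d" "b \<noteq> 0" "G = (U b, E b, W b)" by (auto simp: \<A>_def)
    have "E1 \<inter> U b \<subseteq> {0}" using ker_g_Int_U incl1(2) by blast
    then show ?thesis
      using b ker_g_W_sum[OF b(1,2)] by (simp add: compatible_def)
  next
    assume "G \<in> lift ` \<G>"
    then obtain Y Z S where S: "G = lift (Y, Z, S)" "(Y, Z, S) \<in> \<G>" by auto
    then have "E1 \<inter> Y \<subseteq> {0} \<or> Z \<inter> U1 \<subseteq> {0}"
      using comp1 by (fastforce simp: compatible_def)
    then show ?thesis
      using S(1) kf_sum'[OF \<G>_D(3)[OF S(2)]]
      by (simp add: lift_def compatible_def subspace_sum_commute[of ker_g])
  qed
  note \<C>_family = frame_family_insert[OF t_pos \<A>\<B>_family(1) fr1 this]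

  \<comment> \<open>A nonzero vector of \<open>W1\<close> extends \<open>ker_f\<close> to a member
    of dimension t + 1 inside \<open>subspace_sum ker_f W1\<close>.\<close>
  obtain w where w: "w \<in> W1" "w \<noteq> 0"
    using dim1(4) vec.subspace_0[OF sub1(3)] by (metis less_irrefl singletonI subsetI vec.dim_eq_0)
  let ?E = "subspace_sum ker_f (vec.span {w})"
  have span_w: "vec.span {w} \<subseteq> W1" using w(1) sub1(3) vec.span_minimal by blast
  have dim_w: "vec.dim (vec.span {w}) = 1" using w(2) by simp
  have fr2: "frame t V (ker_f, ?E, subspace_sum ker_f W1)"
    using dim_lift[OF vec.subspace_span, of "{w}"] dim_lift[OF sub1(3) incl1(3)] span_w incl1 dim_w dim1 dim_V kV
      subspace_sum_mono[OF subset_refl span_w] subspace_sum_subset[OF V kV(1), of W1]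
      subset_subspace_sum(1)[OF kf vec.subspace_span, of "{w}"] dim_ker_f
    by (auto simp: frame_def kf sub1 subspace_subspace_sum)
  have "compatible V (ker_f, ?E, subspace_sum ker_f W1) G"
    if G: "G \<in> insert (U1, E1, ker_g) (\<A> \<union> lift ` \<G>)" for G
    using G
  proof (elim insertE UnE)
    assume "G = (U1, E1, ker_g)"
    moreover have "E1 \<inter> ker_f \<subseteq> {0}" using incl1(2) ker_f_Int_ker_g by blast
    ultimately show ?thesis using kf_sum'[OF sub1(3)] by (simp add: compatible_def)
  next
    assume "G \<in> \<A>"
    then obtain b where b: "b \<in> gf d" "b \<noteq> 0" "G = (U b, E b, W b)" by (auto simp: \<A>_def)
    then show ?thesis
      using E_Int_ker_f[OF b(2)] kf_sum[OF sub1(3) b(1,2)] by (simp add: compatible_def)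
  next
    assume "G \<in> lift ` \<G>"
    then obtain Y Z S where S: "G = lift (Y, Z, S)" "(Y, Z, S) \<in> \<G>" by auto
    have "Z \<inter> ker_f \<subseteq> {0}" using \<G>_D(8,9)[OF S(2)] ker_f_Int_ker_g by blast
    moreover have "ker_g \<subseteq> subspace_sum W1 S"
      using comp1[OF S(2)] by (simp add: compatible_def)
    ultimately show ?thesis
      using S(1) lift_sum[OF sub1(3) \<G>_D(3)[OF S(2)]] by (simp add: compatible_def lift_def)
  qed
  note \<D>_family = frame_family_insert[OF t_pos \<C>_family(1) fr2 this]
  \<comment> \<open>The count is q^d - 1 graphs, the lifted family, and the two extra
    frames.\<close>
  have "card (gf d - {0} :: 'a alg_closure set) + 1 = CARD('a) ^ d"
    using card_gf[of d, where 'a='a] finite_gf[of d, where 'a='a] t_less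
    by (simp add: card_Diff_singleton)
  then have "card (insert (ker_f, ?E, subspace_sum ker_f W1)
      (insert (U1, E1, ker_g) (\<A> \<union> lift ` \<G>))) = CARD('a) ^ d + card \<G> + 1"
    using \<D>_family(2) \<C>_family(2) \<A>\<B>_family(2) \<A>(2) \<B>(2) by simp
  then show ?thesis using \<D>_family(1) by blast
qed

end

lemma vector_space_ac_times:
  "vector_space (\<lambda>(c::'a::field) (x :: 'a alg_closure \<times> 'a alg_closure). (to_ac c * fst x, to_ac c * snd x))"
  by unfold_locales (auto simp: distrib_left distrib_right)

lemma exists_field_coordinates:
  fixes V :: "('a::{field,finite} ^ 'n::finite) set"
  assumes V: "vec.subspace V" "vec.dim V = d + t" and t: "0 < t" "t < d"
  obtains f g T p \<nu> where "field_coordinates V d t f g T p \<nu>"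
proof -
  have d: "0 < d" using t by simp
  obtain T :: "'a alg_closure set" where T: "T \<subseteq> gf d" "ac.subspace T" "card T = CARD('a) ^ t"
    using exists_subspace_card[OF ac.vector_space_axioms ac_subspace_gf finite_gf[OF d] card_gf[OF d]] t(2)
    by (metis less_imp_le)
  obtain p where p: "Vector_Spaces.linear (\<lambda>c x. to_ac c * x) (\<lambda>c x. to_ac c * x) p" "range p = T"
    "\<And>x. x \<in> T \<Longrightarrow> p x = x"
    using exists_linear_projection[OF ac.vector_space_axioms T(2)] by metis
  define s where "s = (\<lambda>(c::'a) (x :: 'a alg_closure \<times> 'a alg_closure). (to_ac c * fst x, to_ac c * snd x))"
  have s: "vector_space s"
    unfolding s_def by (rule vector_space_ac_times)
  interpret s: vector_space s by (rule s)
  have sub: "s.subspace (gf d \<times> T)"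
    using ac.subspace_0[OF T(2)] ac.subspace_add[OF T(2)] ac.subspace_scale[OF T(2)]
    by (intro s.subspaceI) (auto simp: s_def zero_prod_def gf_closed)
  have finT: "finite T" using T(1) finite_gf[OF d] finite_subset by blast
  have "card V = card ((gf d :: 'a alg_closure set) \<times> T)"
    using V T(3) card_vec_subspace[OF V(1)] by (simp add: card_cartesian_product card_gf[OF d] power_add)
  then obtain h where h: "Vector_Spaces.linear (*s) s h" "bij_betw h V (gf d \<times> T)"
    using exists_linear_bij_betw[OF vec.vector_space_axioms s V(1) sub finite] finT finite_gf[OF d]
    by (metis finite_cartesian_product)
  have h_lin: "h (x + y) = h x + h y" "h (c *s x) = s c (h x)" for x y c
    using h(1) by (simp_all add: Vector_Spaces.linear_iff)
  have p_lin: "p (x + y) = p x + p y" "p (to_ac c * x) = to_ac c * p x" for x y c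
    using p(1) by (simp_all add: Vector_Spaces.linear_iff)
  have "card T < card (gf d :: 'a alg_closure set)"
    using T(3) t(2) card_field_ge_2[where 'a='a] by (simp add: card_gf[OF d] power_strict_increasing)
  then obtain y where y: "y \<in> gf d" "y \<notin> T"
    by (metis card_mono finT not_le subsetI)
  have p_T: "p x \<in> T" for x using p(2) by blast
  \<comment> \<open>As t < d, some \<open>y\<close> in the field lies outside \<open>T\<close>; its
    difference from its projection is a nonzero element of the kernel of \<open>p\<close>.\<close>
  define \<nu> where "\<nu> = y - p y"
  have "p y = p \<nu> + p (p y)" using p_lin(1)[of \<nu> "p y"] by (simp add: \<nu>_def)
  then have "p \<nu> = 0" using p(3)[OF p_T] by simp
  moreover have "\<nu> \<in> gf d" using y(1) p_T T(1) by (auto simp: \<nu>_def intro!: gf_diff)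
  moreover have "\<nu> \<noteq> 0" using y(2) p_T[of y] by (auto simp: \<nu>_def)
  ultimately have "field_coordinates V d t (fst \<circ> h) (snd \<circ> h) T p \<nu>"
    using V(1) t h T p(3) p_T p_lin by unfold_locales (simp_all add: h_lin s_def)
  then show thesis using that by blast
qed

lemma exists_vec_subspace:
  fixes S :: "('a::{field,finite} ^ 'n::finite) set"
  assumes "vec.subspace S" "k \<le> vec.dim S"
  obtains T where "T \<subseteq> S" "vec.subspace T" "vec.dim T = k"
  using exists_subspace_card[OF vec.vector_space_axioms assms(1) finite card_vec_subspace[OF assms(1)] assms(2)]
    vec_dim_eqI by metis

text \<open>Each step from dimension d to d + t adds q^d frames: the frame singled out for
  \<open>extend\<close> costs one, which the two extra frames more than repay. The equation is the
  sum of this progression, starting from q^(t+r) + 1 in dimension 2t + r, cleared of its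
  denominator.\<close>

lemma exists_frame_family_pos:
  fixes V :: "('a::{field,finite} ^ 'n::finite) set"
  assumes "0 < t" "0 < r" "vec.subspace V" "vec.dim V = (m + 2) * t + r"
  shows "\<exists>\<F>. frame_family t V \<F> \<and>
    card \<F> * (CARD('a) ^ t - 1) + CARD('a) ^ (t + r) + 1 = CARD('a) ^ vec.dim V + CARD('a) ^ t"
  using assms(3,4)
proof (induction m arbitrary: V)
  case 0
  define d where "d = t + r"
  have d: "vec.dim V = d + t" "t < d"
    using 0(2) assms(1,2) by (simp_all add: d_def)
  obtain f g T p \<nu> where "field_coordinates V d t f g T p \<nu>"
    using exists_field_coordinates[OF 0(1) d(1) assms(1) d(2)] .
  then interpret field_coordinates V d t f g T p \<nu> .
  have "Suc t \<le> vec.dim ker_g" using dim_ker_g t_less by simp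
  then obtain E1 where E1: "E1 \<subseteq> ker_g" "vec.subspace E1" "vec.dim E1 = Suc t"
    using exists_vec_subspace[OF subspaces(4)] by metis
  obtain U1 where U1: "U1 \<subseteq> E1" "vec.subspace U1" "vec.dim U1 = t"
    using exists_vec_subspace[OF E1(2), of t] E1(3) by auto
  \<comment> \<open>\<open>ker_g\<close> has dimension t + r, so \<open>W1\<close> must have
    dimension r. That r is positive makes \<open>W1\<close> nonzero and left room for
    \<open>E1\<close>.\<close>
  have "r \<le> vec.dim ker_g" using dim_ker_g by (simp add: d_def)
  then obtain W1 where W1: "W1 \<subseteq> ker_g" "vec.subspace W1" "vec.dim W1 = r"
    using exists_vec_subspace[OF subspaces(4)] by metis
  obtain \<F> where \<F>: "frame_family t V \<F>" "card \<F> = CARD('a) ^ d + card ({} :: ('a, 'n) frame set) + 1"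
    using extend[of "{}" U1 E1 W1] E1 U1 W1 assms(2)
    by (auto simp: d_def frame_family_def)
  obtain Q where Q: "CARD('a) ^ t = Suc Q"
    using gr0_implies_Suc[of "CARD('a) ^ t"] by auto
  have "card \<F> * (CARD('a) ^ t - 1) + CARD('a) ^ (t + r) + 1 = CARD('a) ^ vec.dim V + CARD('a) ^ t"
    using \<F>(2) by (simp add: dim_V d_def power_add Q algebra_simps)
  then show ?case using \<F>(1) by blast
next
  case (Suc m)
  define d where "d = (m + 2) * t + r"
  have d: "vec.dim V = d + t" "t < d"
    using Suc(3) assms(1,2) by (simp_all add: d_def)
  obtain f g T p \<nu> where "field_coordinates V d t f g T p \<nu>"
    using exists_field_coordinates[OF Suc(2) d(1) assms(1) d(2)] .
  then interpret field_coordinates V d t f g T p \<nu> .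
  obtain \<G> where \<G>: "frame_family t ker_g \<G>"
    "card \<G> * (CARD('a) ^ t - 1) + CARD('a) ^ (t + r) + 1 = CARD('a) ^ d + CARD('a) ^ t"
    using Suc.IH[OF subspaces(4)] dim_ker_g by (auto simp: d_def)
  \<comment> \<open>A frame has to be singled out for \<open>extend\<close>; an empty family would
    contradict the size equation.\<close>
  have "\<G> \<noteq> {}"
  proof
    assume "\<G> = {}"
    then have "CARD('a) ^ (t + r) + 1 = CARD('a) ^ d + CARD('a) ^ t" using \<G>(2) by simp
    moreover have "CARD('a) ^ (t + r) \<le> CARD('a) ^ d"
      by (intro power_increasing) (auto simp: d_def Suc_le_eq)
    moreover have "CARD('a) ^ 1 \<le> CARD('a) ^ t"
      using assms(1) by (intro power_increasing) (auto simp: Suc_le_eq)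
    ultimately show False
      using card_field_ge_2[where 'a='a] unfolding power_one_right by linarith
  qed
  then obtain U1 E1 W1 where F1: "(U1, E1, W1) \<in> \<G>" by auto
  have F1': "frame t ker_g (U1, E1, W1)" "\<And>F. F \<in> \<G> - {(U1, E1, W1)} \<Longrightarrow> compatible ker_g (U1, E1, W1) F"
    using \<G>(1) F1 by (auto simp: frame_family_def pairwise_def)
  have dim_W1: "vec.dim W1 + t = d" using F1'(1) dim_ker_g by (simp add: frame_def)
  then have "vec.dim W1 > 0" using t_less by linarith
  moreover have "E1 \<subseteq> ker_g" using F1'(1) by (auto simp: frame_def)
  moreover have "frame_family t ker_g (\<G> - {(U1, E1, W1)})"
    using \<G>(1) by (auto simp: frame_family_def pairwise_def)
  ultimately obtain \<F> where \<F>: "frame_family t V \<F>"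
    "card \<F> = CARD('a) ^ d + card (\<G> - {(U1, E1, W1)}) + 1"
    using extend[of "\<G> - {(U1, E1, W1)}" U1 E1 W1] F1' dim_W1 unfolding frame_def by auto
  moreover have "card (\<G> - {(U1, E1, W1)}) + 1 = card \<G>"
    using F1 by (metis Suc_eq_plus1 card_Suc_Diff1 finite)
  ultimately have card: "card \<F> = CARD('a) ^ d + card \<G>" by simp
  have "CARD('a) ^ d * (CARD('a) ^ t - 1) + CARD('a) ^ d = CARD('a) ^ d * (CARD('a) ^ t - 1 + 1)"
    by (simp only: distrib_left mult_1_right)
  then have "CARD('a) ^ d * (CARD('a) ^ t - 1) + CARD('a) ^ d = CARD('a) ^ vec.dim V"
    by (simp add: dim_V power_add)
  then have "card \<F> * (CARD('a) ^ t - 1) + CARD('a) ^ (t + r) + 1 = CARD('a) ^ vec.dim V + CARD('a) ^ t"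
    using \<G>(2) by (simp add: card add_mult_distrib)
  then show ?case using \<F>(1) by blast
qed

section \<open>The case of a divisible dimension\<close>

text \<open>On \<open>gf (t * m)\<close> this is the trace to the subfield
  \<open>gf t\<close>.\<close>

definition gf_trace :: "nat \<Rightarrow> nat \<Rightarrow> 'a::{field,finite} alg_closure \<Rightarrow> 'a alg_closure" where
  "gf_trace t m y = (\<Sum>i<m. y ^ (CARD('a) ^ (t * i)))"

lemma gf_trace_add: "gf_trace t m (x + y) = gf_trace t m x + gf_trace t m y"
  by (simp add: gf_trace_def frobenius_pow_add sum.distrib)

lemma gf_trace_mult:
  assumes "c \<in> gf t"
  shows "gf_trace t m (c * y) = c * gf_trace t m y"
proof -
  have "c ^ (CARD('a) ^ (t * i)) = c" for i
    using gf_mono[of t "t * i"] assms by (auto simp: gf_def)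
  then show ?thesis
    by (simp add: gf_trace_def power_mult_distrib sum_distrib_left)
qed

text \<open>Raising to the power q^t shifts the conjugates by one place, and the one after the last
  is \<open>y\<close> again.\<close>

lemma gf_trace_in_gf:
  fixes y :: "'a::{field,finite} alg_closure"
  assumes "y \<in> gf (t * m)"
  shows "gf_trace t m y \<in> gf t"
proof -
  let ?a = "\<lambda>i. y ^ (CARD('a) ^ (t * i))"
  have "gf_trace t m y ^ (CARD('a) ^ t) = (\<Sum>i<m. ?a (Suc i))"
    by (simp add: gf_trace_def frobenius_pow_sum power_mult mult.commute flip: power_mult power_add)
  also have "\<dots> + ?a 0 = (\<Sum>i<m. ?a i) + ?a m"
    using sum.lessThan_Suc_shift[of ?a m] sum.lessThan_Suc[of ?a m] by (simp add: add.commute)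
  finally have "gf_trace t m y ^ (CARD('a) ^ t) + y = gf_trace t m y + y"
    using assms by (simp add: gf_trace_def gf_def)
  then show ?thesis by (simp add: gf_def)
qed

text \<open>As a polynomial the trace has degree less than the order of the field, and it is nonzero
  because only the summand i = 0 contributes to the linear coefficient.\<close>

lemma gf_trace_nonzero:
  assumes t: "0 < t" "0 < m"
  obtains y :: "'a::{field,finite} alg_closure" where "y \<in> gf (t * m)" "gf_trace t m y \<noteq> 0"
proof (rule ccontr)
  assume "\<not> thesis"
  then have zero: "gf_trace t m y = 0" if "y \<in> gf (t * m)" for y :: "'a alg_closure"
    using that \<open>\<And>y. y \<in> gf (t * m) \<Longrightarrow> gf_trace t m y \<noteq> 0 \<Longrightarrow> thesis\<close> by blast
  define P :: "'a alg_closure poly" where "P = (\<Sum>i<m. monom 1 (CARD('a) ^ (t * i)))"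
  have val: "poly P y = gf_trace t m y" for y
    by (simp add: P_def gf_trace_def poly_sum poly_monom)
  have "CARD('a) ^ (t * i) = 1 \<longleftrightarrow> i = 0" for i
    using t(1) card_field_power_inject[where 'a='a, of "t * i" 0] by simp
  then have "coeff P 1 = 1"
    using t(2) by (simp add: P_def coeff_sum)
  then have P0: "P \<noteq> 0" by auto
  have "Polynomial.degree P \<le> CARD('a) ^ (t * (m - 1))"
    unfolding P_def
    by (intro degree_sum_le order.trans[OF degree_monom_le] power_increasing) (auto simp: Suc_le_eq)
  also have "\<dots> < CARD('a) ^ (t * m)"
    using t card_field_ge_2[where 'a='a] by (intro power_strict_increasing) auto
  also have "\<dots> = card (gf (t * m) :: 'a alg_closure set)"
    using t by (simp add: card_gf)
  also have "\<dots> \<le> card {y. poly P y = 0}"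
    by (rule card_mono) (auto simp: val zero poly_roots_finite[OF P0, unfolded val])
  also have "\<dots> \<le> Polynomial.degree P"
    by (rule card_poly_roots_bound[OF P0])
  finally show False by simp
qed

text \<open>The map raising to the power q^t fixes the coefficients and so permutes the roots. If it
  moves \<nu>, the image is the other root - a - \<nu>, which it sends back to \<nu>; its square
  fixes \<nu> in either case.\<close>

lemma quadratic_in_gf:
  assumes a: "a \<in> gf t" "b \<in> gf t" and eq: "\<nu> * \<nu> + a * \<nu> + b = 0"
  shows "\<nu> \<in> gf (2 * t)"
proof -
  let ?\<sigma> = "\<lambda>y. y ^ (CARD('a) ^ t)"
  have root: "?\<sigma> y * ?\<sigma> y + a * ?\<sigma> y + b = ?\<sigma> (y * y + a * y + b)" for y
    using a by (simp add: frobenius_pow_add power_mult_distrib gf_def)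
  define \<mu> where "\<mu> = ?\<sigma> \<nu>"
  have "\<mu> * \<mu> + a * \<mu> + b = 0"
    using root[of \<nu>] unfolding \<mu>_def eq by (simp add: power_0_left)
  moreover have "(\<mu> - \<nu>) * (\<mu> + \<nu> + a) = (\<mu> * \<mu> + a * \<mu> + b) - (\<nu> * \<nu> + a * \<nu> + b)"
    by (simp add: algebra_simps)
  ultimately have "(\<mu> - \<nu>) * (\<mu> + \<nu> + a) = 0"
    by (simp only: eq diff_zero)
  then consider "\<mu> = \<nu>" | "\<mu> + \<nu> + a = 0"
    by auto
  then have "?\<sigma> \<mu> = \<nu>"
  proof cases
    case 1
    then show ?thesis by (simp add: \<mu>_def)
  next
    case 2
    have "?\<sigma> \<mu> + \<mu> + a = ?\<sigma> (\<mu> + \<nu> + a)"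
      using a(1) by (simp add: frobenius_pow_add gf_def \<mu>_def)
    also have "\<dots> = \<mu> + \<nu> + a"
      unfolding 2 by (simp add: power_0_left)
    finally show ?thesis by simp
  qed
  then show ?thesis
    by (simp add: gf_def \<mu>_def mult_2 power_add power_mult)
qed

text \<open>
  A space \<open>V\<close> of dimension \<open>n\<close>, identified with the field of order \<open>q^n\<close> by \<open>f\<close>. The frames form
  the orbit of a single one under multiplication, namely of the subfield of order \<open>q^t\<close>, its sum with
  the line of \<open>\<nu>\<close>, and the kernel of a functional \<open>h\<close> over the subfield.
\<close>
locale field_orbit =
  fixes V :: "('a::{field,finite} ^ 'n::finite) set" and n t :: nat
    and f :: "'a ^ 'n \<Rightarrow> 'a alg_closure" and h :: "'a alg_closure \<Rightarrow> 'a alg_closure"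
    and \<nu> y0 :: "'a alg_closure"
  assumes V: "vec.subspace V" and t_pos: "0 < t" and t_dvd: "t dvd n" and n_pos: "0 < n"
    and f_add: "f (x + y) = f x + f y" and f_scale: "f (c *s x) = to_ac c * f x"
    and bij: "bij_betw f V (gf n)"
    and h_add: "h (a + b) = h a + h b" and h_mult: "k \<in> gf t \<Longrightarrow> h (k * a) = k * h a"
    and h_in: "a \<in> gf n \<Longrightarrow> h a \<in> gf t"
    and h_1: "h 1 = 0" and h_\<nu>: "h \<nu> = 0" and y0: "y0 \<in> gf n" "h y0 = 1"
    and \<nu>: "\<nu> \<in> gf n" "\<nu> \<notin> gf (2 * t)"
begin

text \<open>For nonzero \<open>x\<close> this is the preimage under \<open>f\<close> of the multiple
  of \<open>S\<close> by \<open>x\<close>.\<close>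

definition "subspace_of S x = {v \<in> V. f v / x \<in> S}"
definition "line_sum = (\<lambda>(a, c). a + to_ac c * \<nu>) ` (gf t \<times> UNIV)"
definition "ker_h = {y \<in> gf n. h y = 0}"
definition "frame_of x = (subspace_of (gf t) x, subspace_of line_sum x, subspace_of ker_h x)"

lemma h_0: "h 0 = 0" using h_add[of 0 0] by (metis add_0 add_cancel_right_right)
lemma f_0: "f 0 = 0" using f_add[of 0 0] by (metis add_0 add_cancel_right_right)
lemma h_diff: "h (a - b) = h a - h b" using h_add[of "a - b" b] by simp
lemma h_scale: "h (to_ac c * a) = to_ac c * h a" by (rule h_mult) simp
lemma f_diff: "f (x - y) = f x - f y" using f_add[of "x - y" y] by simp
lemma f_in: "v \<in> V \<Longrightarrow> f v \<in> gf n" using bij by (auto simp: bij_betw_def)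
lemma f_eqI: "v \<in> V \<Longrightarrow> w \<in> V \<Longrightarrow> f v = f w \<Longrightarrow> v = w"
  using bij by (auto simp: bij_betw_def inj_on_def)
lemma f_eq_0: "v \<in> V \<Longrightarrow> f v = 0 \<Longrightarrow> v = 0"
  using f_eqI[OF _ vec.subspace_0[OF V]] f_0 by simp

lemma gf_t_subset: "gf t \<subseteq> (gf n :: 'a alg_closure set)"
  by (rule gf_mono[OF t_dvd])

lemma obtain_preimage:
  assumes "y \<in> gf n"
  obtains v where "v \<in> V" "f v = y"
proof -
  have "y \<in> f ` V"
    using bij assms by (simp add: bij_betw_def)
  then show thesis using that by auto
qed

lemma subspace_subspace_of:
  assumes "ac.subspace S"
  shows "vec.subspace (subspace_of S x)"
proof (rule vec.subspaceI)
  show "0 \<in> subspace_of S x"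
    using ac.subspace_0[OF assms] vec.subspace_0[OF V] by (simp add: subspace_of_def f_0)
next
  fix v w assume "v \<in> subspace_of S x" "w \<in> subspace_of S x"
  then show "v + w \<in> subspace_of S x"
    using ac.subspace_add[OF assms] vec.subspace_add[OF V]
    by (simp add: subspace_of_def f_add add_divide_distrib)
next
  fix c v assume "v \<in> subspace_of S x"
  then show "c *s v \<in> subspace_of S x"
    using ac.subspace_scale[OF assms, of "f v / x" c] vec.subspace_scale[OF V]
    by (simp add: subspace_of_def f_scale)
qed

lemma card_subspace_of:
  assumes "S \<subseteq> gf n" and x: "x \<in> gf n" "x \<noteq> 0"
  shows "card (subspace_of S x) = card S"
proof (rule bij_betw_same_card)
  show "bij_betw (\<lambda>v. f v / x) (subspace_of S x) S"
  proof (rule bij_betw_imageI)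
    show "inj_on (\<lambda>v. f v / x) (subspace_of S x)"
      using x by (auto simp: inj_on_def subspace_of_def intro: f_eqI)
    show "(\<lambda>v. f v / x) ` subspace_of S x = S"
    proof (intro equalityI subsetI)
      fix s assume s: "s \<in> S"
      then have "x * s \<in> gf n" using assms by (auto intro: gf_mult)
      then obtain v where "v \<in> V" "f v = x * s" by (rule obtain_preimage)
      then show "s \<in> (\<lambda>v. f v / x) ` subspace_of S x"
        using s x by (intro image_eqI[of _ _ v]) (auto simp: subspace_of_def)
    qed (auto simp: subspace_of_def)
  qed
qed

lemma \<nu>_notin: "\<nu> \<notin> gf t"
  using \<nu>(2) gf_mono[of t "2 * t", where 'a='a] by auto

lemma subspace_line_sum: "ac.subspace line_sum"
proof (rule ac.subspaceI)
  show "0 \<in> line_sum"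
    unfolding line_sum_def by (intro image_eqI[of _ _ "(0, 0)"]) auto
next
  fix x y assume "x \<in> line_sum" "y \<in> line_sum"
  then obtain a c b e where "x = a + to_ac c * \<nu>" "y = b + to_ac e * \<nu>" "a \<in> gf t" "b \<in> gf t"
    by (auto simp: line_sum_def)
  then show "x + y \<in> line_sum"
    unfolding line_sum_def
    by (intro image_eqI[of _ _ "(a + b, c + e)"]) (auto simp: algebra_simps gf_closed)
next
  fix k x assume "x \<in> line_sum"
  then obtain a c where "x = a + to_ac c * \<nu>" "a \<in> gf t" by (auto simp: line_sum_def)
  then show "to_ac k * x \<in> line_sum"
    unfolding line_sum_def
    by (intro image_eqI[of _ _ "(to_ac k * a, k * c)"]) (auto simp: algebra_simps gf_closed)
qed

lemma card_line_sum: "card line_sum = CARD('a) ^ Suc t"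
proof -
  have "inj_on (\<lambda>(a, c). a + to_ac c * \<nu>) (gf t \<times> UNIV)"
  proof (rule inj_onI, clarify)
    fix a c a' c'
    assume a: "a \<in> gf t" "a' \<in> gf t" and eq: "a + to_ac c * \<nu> = a' + to_ac c' * \<nu>"
    have "c = c'"
    proof (rule ccontr)
      assume "c \<noteq> c'"
      moreover have "to_ac (c - c') * \<nu> = a' - a" using eq by (simp add: algebra_simps)
      ultimately have "\<nu> = (a' - a) / to_ac (c - c')" by (simp add: field_simps)
      then show False using \<nu>_notin a by (auto intro!: gf_closed)
    qed
    then show "a = a' \<and> c = c'" using eq by simp
  qed
  then show ?thesis
    unfolding line_sum_def using t_pos by (simp add: card_image card_cartesian_product card_gf)
qed

lemma gf_subset_line_sum: "gf t \<subseteq> line_sum"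
proof
  fix a assume "a \<in> (gf t :: 'a alg_closure set)"
  then show "a \<in> line_sum" unfolding line_sum_def by (intro image_eqI[of _ _ "(a, 0)"]) auto
qed

lemma line_sum_subset_ker_h: "line_sum \<subseteq> ker_h"
proof
  fix z assume "z \<in> line_sum"
  then obtain a c where a: "a \<in> gf t" "z = a + to_ac c * \<nu>" by (auto simp: line_sum_def)
  have "h a = a * h 1" using h_mult[OF a(1), of 1] by simp
  then have "h z = 0" using a by (simp add: h_add h_scale h_1 h_\<nu>)
  then show "z \<in> ker_h" using a \<nu>(1) gf_t_subset by (auto simp: ker_h_def intro!: gf_closed)
qed

lemma subspace_ker_h: "ac.subspace ker_h"
  by (rule ac.subspaceI) (auto simp: ker_h_def h_0 h_add h_scale gf_closed)

text \<open>Since h y0 = 1, the field is the direct sum of \<open>ker_h\<close> and the multiples of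
  \<open>y0\<close> by \<open>gf t\<close>.\<close>

lemma card_ker_h: "card ker_h * CARD('a) ^ t = CARD('a) ^ n"
proof -
  have "bij_betw (\<lambda>(z, k). z + k * y0) (ker_h \<times> gf t) (gf n)"
  proof (rule bij_betw_imageI)
    show "inj_on (\<lambda>(z, k). z + k * y0) (ker_h \<times> gf t)"
    proof (rule inj_onI, clarify)
      fix z k z' k'
      assume z: "z \<in> ker_h" "z' \<in> ker_h" "k \<in> gf t" "k' \<in> gf t" and eq: "z + k * y0 = z' + k' * y0"
      have "h (z + k * y0) = h (z' + k' * y0)" by (simp add: eq)
      then have "k = k'" using z by (simp add: h_add h_mult y0 ker_h_def)
      then show "z = z' \<and> k = k'" using eq by simp
    qed
    show "(\<lambda>(z, k). z + k * y0) ` (ker_h \<times> gf t) = gf n"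
    proof (intro equalityI subsetI)
      fix y assume y: "y \<in> (gf n :: 'a alg_closure set)"
      then have "y - h y * y0 \<in> ker_h"
        using h_in[OF y] y0 gf_t_subset by (auto simp: ker_h_def h_diff h_mult intro!: gf_closed)
      then show "y \<in> (\<lambda>(z, k). z + k * y0) ` (ker_h \<times> gf t)"
        using h_in[OF y] by (intro image_eqI[of _ _ "(y - h y * y0, h y)"]) auto
    next
      fix y assume "y \<in> (\<lambda>(z, k). z + k * y0) ` (ker_h \<times> gf t)"
      then show "y \<in> gf n"
        using y0(1) gf_t_subset by (auto simp: ker_h_def intro!: gf_closed)
    qed
  qed
  then have "card (ker_h \<times> (gf t :: 'a alg_closure set)) = card (gf n :: 'a alg_closure set)"
    by (rule bij_betw_same_card)
  then show ?thesis
    using t_pos n_pos by (simp add: card_cartesian_product card_gf)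
qed

lemma dim_V: "vec.dim V = n"
  using bij_betw_same_card[OF bij] n_pos by (intro vec_dim_eqI V) (simp add: card_gf)

lemma frame_frame_of:
  assumes x: "x \<in> gf n" "x \<noteq> 0"
  shows "frame t V (frame_of x)"
proof -
  note sub = ac_subspace_gf subspace_line_sum subspace_ker_h
  have incl: "line_sum \<subseteq> gf n" "ker_h \<subseteq> gf n" "gf t \<subseteq> (gf n :: 'a alg_closure set)"
    using line_sum_subset_ker_h gf_t_subset by (auto simp: ker_h_def)
  have "vec.dim (subspace_of (gf t) x) = t"
    using card_subspace_of[OF incl(3) x] t_pos
    by (intro vec_dim_eqI subspace_subspace_of sub) (simp add: card_gf)
  moreover have "vec.dim (subspace_of line_sum x) = Suc t"
    using card_subspace_of[OF incl(1) x] card_line_sum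
    by (intro vec_dim_eqI subspace_subspace_of sub) simp
  moreover have "CARD('a) ^ (vec.dim (subspace_of ker_h x) + t) = CARD('a) ^ n"
    using card_subspace_of[OF incl(2) x] card_ker_h card_vec_subspace[OF subspace_subspace_of[OF sub(3)]]
    by (simp add: power_add)
  moreover have "subspace_of (gf t) x \<subseteq> subspace_of line_sum x" "subspace_of line_sum x \<subseteq> subspace_of ker_h x"
    using gf_subset_line_sum line_sum_subset_ker_h by (auto simp: subspace_of_def)
  moreover have "subspace_of ker_h x \<subseteq> V" by (auto simp: subspace_of_def)
  ultimately show ?thesis
    using dim_V by (simp add: frame_def frame_of_def subspace_subspace_of sub)
qed

text \<open>Over \<open>gf t\<close> both members are hyperplanes, so it suffices that one is not
  contained in the other: then some z in the second but not in the first supplies the missing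
  direction.\<close>

lemma ker_h_sum:
  assumes x: "x \<in> gf n" "x \<noteq> 0" "x' \<in> gf n" "x' \<noteq> 0" "x' / x \<notin> gf t"
  shows "V \<subseteq> subspace_sum (subspace_of ker_h x) (subspace_of ker_h x')"
proof
  fix v assume v: "v \<in> V"
  obtain z where z: "z \<in> gf n" "h (z / x') = 0" "h (z / x) \<noteq> 0"
  proof (rule ccontr)
    assume none: "\<not> thesis"
    note found = that
    \<comment> \<open>Without such a z, the functional y \<mapsto> h (y / x) vanishes wherever h (y
      / x') does, hence is a multiple of it; \<open>y0\<close> scaled by x' determines the
      factor.\<close>
    have proportional: "h (y / x) = h (y / x') * h (x' * y0 / x)" if y: "y \<in> gf n" for y
    proof -
      have hy: "h (y / x') \<in> gf t" using y x by (intro h_in gf_divide)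
      define z where "z = y - h (y / x') * (x' * y0)"
      have "z \<in> gf n" using y x hy y0(1) gf_t_subset by (auto simp: z_def intro!: gf_closed)
      moreover have "z / x' = y / x' - h (y / x') * y0"
        using x by (simp add: z_def field_simps)
      then have "h (z / x') = 0" by (simp add: h_diff h_mult[OF hy] y0)
      ultimately have "h (z / x) = 0" using found none by blast
      moreover have "z / x = y / x - h (y / x') * (x' * y0 / x)"
        by (simp add: z_def diff_divide_distrib)
      then have "h (z / x) = h (y / x) - h (y / x') * h (x' * y0 / x)"
        by (simp only: h_diff h_mult[OF hy])
      ultimately show ?thesis by simp
    qed
    define c where "c = h (x' * y0 / x)"
    have c: "c \<in> gf t" using x y0 by (auto simp: c_def intro!: h_in gf_closed)
    define \<delta> where "\<delta> = 1 / x - c / x'"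
    have "\<delta> \<noteq> 0"
    proof
      assume "\<delta> = 0"
      then have "c = x' / x" using x by (simp add: \<delta>_def field_simps)
      then show False using c x(5) by simp
    qed
    have \<delta>: "\<delta> \<in> gf n" using c gf_t_subset x by (auto simp: \<delta>_def intro!: gf_closed gf_1)
    \<comment> \<open>Proportionality says that h vanishes on all multiples of \<delta>; this
      \<open>y\<close> makes the multiple equal to \<open>y0\<close>, where h is 1.\<close>
    define y where "y = y0 / \<delta>"
    have "y \<in> gf n" using y0 \<delta> by (simp add: y_def gf_divide)
    have "y0 = y * \<delta>" using \<open>\<delta> \<noteq> 0\<close> by (simp add: y_def)
    also have "\<dots> = y / x - c * (y / x')" by (simp add: \<delta>_def right_diff_distrib)
    finally have "h y0 = h (y / x) - c * h (y / x')" by (simp only: h_diff h_mult[OF c])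
    also have "\<dots> = 0" using proportional[OF \<open>y \<in> gf n\<close>] by (simp add: c_def)
    finally show False using y0(2) by simp
  qed
  \<comment> \<open>The factor is chosen so that subtracting \<open>k * z\<close> brings
    \<open>f v\<close> into the first hyperplane.\<close>
  define k where "k = h (f v / x) / h (z / x)"
  have k: "k \<in> gf t" using f_in[OF v] x z by (auto simp: k_def intro!: gf_divide h_in)
  have "f v - k * z \<in> gf n" using f_in[OF v] k z(1) gf_t_subset by (auto intro!: gf_closed)
  then obtain w where w: "w \<in> V" "f w = f v - k * z" by (rule obtain_preimage)
  have "h ((f v - k * z) / x) = h (f v / x) - k * h (z / x)"
    using h_mult[OF k, of "z / x"] by (simp add: diff_divide_distrib h_diff)
  then have 1: "h (f w / x) = 0" using w z(3) by (simp add: k_def)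
  have 2: "h (k * z / x') = 0" using h_mult[OF k, of "z / x'"] z(2) by simp
  show "v \<in> subspace_sum (subspace_of ker_h x) (subspace_of ker_h x')"
  proof (rule subspace_sumI_diff)
    show "w \<in> subspace_of ker_h x"
      using w(1) 1 gf_divide[OF f_in[OF w(1)] x(1)] by (simp add: subspace_of_def ker_h_def)
    have vw: "v - w \<in> V" and "f (v - w) = k * z"
      using v w V by (simp_all add: f_diff vec.subspace_diff)
    then show "v - w \<in> subspace_of ker_h x'"
      using 2 gf_divide[OF f_in[OF vw] x(3)] by (simp add: subspace_of_def ker_h_def)
  qed
qed

text \<open>With \<rho> = x' / x, nonzero vectors in both intersections give a' \<rho> = a + c \<nu>
  and b' / \<rho> = b + e \<nu> with a, b, a', b' in \<open>gf t\<close>. If c or e were 0, then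
  \<rho> would lie in \<open>gf t\<close>. The product eliminates \<rho> and is a quadratic equation
  for \<nu> over \<open>gf t\<close> with leading coefficient c e, which contradicts the choice of
  \<nu>.\<close>

lemma line_sum_Int:
  assumes x: "x \<noteq> 0" "x' \<noteq> 0" "x' / x \<notin> gf t"
  shows "subspace_of line_sum x \<inter> subspace_of (gf t) x' \<subseteq> {0} \<or>
    subspace_of line_sum x' \<inter> subspace_of (gf t) x \<subseteq> {0}"
proof (rule ccontr)
  assume "\<not> ?thesis"
  then obtain v w where v: "v \<in> subspace_of line_sum x" "v \<in> subspace_of (gf t) x'" "v \<noteq> 0"
    and w: "w \<in> subspace_of line_sum x'" "w \<in> subspace_of (gf t) x" "w \<noteq> 0"
    by blast
  define \<rho> where "\<rho> = x' / x"
  have \<rho>: "\<rho> \<noteq> 0" "\<rho> \<notin> gf t" using x by (auto simp: \<rho>_def)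
  define a' b' where "a' = f v / x'" and "b' = f w / x"
  have "f v \<noteq> 0" "f w \<noteq> 0" using v w f_eq_0 by (auto simp: subspace_of_def)
  then have nz: "a' \<noteq> 0" "b' \<noteq> 0" using x by (auto simp: a'_def b'_def)
  have in': "a' \<in> gf t" "b' \<in> gf t" using v(2) w(2) by (auto simp: a'_def b'_def subspace_of_def)
  obtain a c where a: "a \<in> gf t" "f v / x = a + to_ac c * \<nu>"
    using v(1) by (auto simp: subspace_of_def line_sum_def)
  obtain b e where b: "b \<in> gf t" "f w / x' = b + to_ac e * \<nu>"
    using w(1) by (auto simp: subspace_of_def line_sum_def)
  have e1: "a' * \<rho> = a + to_ac c * \<nu>" using a x by (simp add: a'_def \<rho>_def)
  have e2: "b' / \<rho> = b + to_ac e * \<nu>" using b x by (simp add: b'_def \<rho>_def)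
  have c: "c \<noteq> 0"
  proof
    assume "c = 0"
    then have "\<rho> = a / a'" using e1 nz by (simp add: field_simps)
    then show False using \<rho>(2) a(1) in' by (simp add: gf_divide)
  qed
  have e: "e \<noteq> 0"
  proof
    assume "e = 0"
    then have "b' = b * \<rho>" using e2 \<rho>(1) by (simp add: field_simps)
    then have "\<rho> = b' / b" using nz by auto
    then show False using \<rho>(2) b(1) in' by (simp add: gf_divide)
  qed
  have "(a + to_ac c * \<nu>) * (b + to_ac e * \<nu>) = a' * b'"
    unfolding e1[symmetric] e2[symmetric] using \<rho>(1) by simp
  then have eq: "to_ac (c * e) * (\<nu> * \<nu>) + (a * to_ac e + b * to_ac c) * \<nu> + (a * b - a' * b') = 0"
    by (simp add: algebra_simps)
  have "\<nu> * \<nu> + (a * to_ac e + b * to_ac c) / to_ac (c * e) * \<nu> + (a * b - a' * b') / to_ac (c * e)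
      = (to_ac (c * e) * (\<nu> * \<nu>) + (a * to_ac e + b * to_ac c) * \<nu> + (a * b - a' * b')) / to_ac (c * e)"
    using c e by (simp add: add_divide_distrib distrib_right del: to_ac_mult)
  also have "\<dots> = 0" by (simp only: eq) simp
  finally have "\<nu> * \<nu> + (a * to_ac e + b * to_ac c) / to_ac (c * e) * \<nu> +
      (a * b - a' * b') / to_ac (c * e) = 0" .
  then have "\<nu> \<in> gf (2 * t)"
    by (rule quadratic_in_gf[rotated 2]) (auto intro!: gf_closed to_ac_in_gf a(1) b(1) in' simp del: to_ac_mult)
  then show False using \<nu>(2) by simp
qed

text \<open>Multiples of the subfield by x and x' coincide as soon as x' / x is in
  \<open>gf t\<close>, so \<open>R\<close> keeps one representative per multiple. The multiples
  partition the nonzero vectors of \<open>V\<close>, which gives the size.\<close>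

lemma exists_family:
  "\<exists>\<F>. frame_family t V \<F> \<and> card \<F> * (CARD('a) ^ t - 1) + 1 = CARD('a) ^ n"
proof -
  let ?U = "subspace_of (gf t)" and ?K = "gf n - {0} :: 'a alg_closure set"
  obtain R where R: "R \<subseteq> ?K" "inj_on ?U R" "?U ` ?K = ?U ` R"
    using subset_image_inj[of "?U ` ?K" ?U ?K] by auto
  have ratio: "x' / x \<notin> gf t" if "x \<in> R" "x' \<in> R" "x \<noteq> x'" for x x'
  proof
    assume k: "x' / x \<in> gf t"
    have nz: "x \<noteq> 0" "x' \<noteq> 0" using R(1) that by auto
    have "f v / x \<in> gf t \<longleftrightarrow> f v / x' \<in> gf t" for v
      using gf_mult[OF k, of "f v / x'"] gf_divide[OF _ k, of "f v / x"] nz by auto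
    then have "?U x = ?U x'" by (auto simp: subspace_of_def)
    then show False using R(2) that by (auto simp: inj_on_def)
  qed
  have nz: "x \<in> gf n" "x \<noteq> 0" if "x \<in> R" for x using R(1) that by auto
  have fr: "frame t V (frame_of x)" if "x \<in> R" for x
    using frame_frame_of nz[OF that] by blast
  have comp: "compatible V (frame_of x) (frame_of x')" if "x \<in> R" "x' \<in> R" "x \<noteq> x'" for x x'
    using line_sum_Int ker_h_sum nz that ratio[OF that] by (simp add: compatible_def frame_of_def)
  note family = frame_family_image[where I = R and F = frame_of, OF t_pos fr comp]
  have sub: "vec.subspace S" "vec.dim S = t" if "S \<in> ?U ` R" for S
    using that fr by (auto simp: frame_def frame_of_def)
  have disj: "pairwise (\<lambda>S S'. S \<inter> S' \<subseteq> {0}) (?U ` R)"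
  proof (rule pairwiseI)
    fix S S' assume S: "S \<in> ?U ` R" "S' \<in> ?U ` R" "S \<noteq> S'"
    then obtain x x' where x: "x \<in> R" "x' \<in> R" "x \<noteq> x'" "S = ?U x" "S' = ?U x'" by auto
    then have "compatible V (frame_of x) (frame_of x')" by (intro comp)
    moreover have "?U x \<subseteq> subspace_of line_sum x" "?U x' \<subseteq> subspace_of line_sum x'"
      using gf_subset_line_sum by (auto simp: subspace_of_def)
    ultimately show "S \<inter> S' \<subseteq> {0}"
      using x(4,5) unfolding compatible_def frame_of_def by blast
  qed
  have cover: "V \<inter> (\<Union>(?U ` R) - {0}) = V \<inter> (UNIV - {0})"
  proof -
    have "v \<in> \<Union>(?U ` R)" if v: "v \<in> V" "v \<noteq> 0" for v
    proof -
      have "f v \<in> ?K" using v f_eq_0 f_in by auto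
      moreover have "v \<in> ?U (f v)" using v f_eq_0 by (auto simp: subspace_of_def)
      ultimately show ?thesis using R(3) by blast
    qed
    then show ?thesis by blast
  qed
  have "int (card (V \<inter> (UNIV - {0}))) = (\<Sum>S\<in>?U ` R. int (card (V \<inter> (S - {0}))))"
    using card_nonzero_Union[OF sub(1) disj, of V] by (simp only: cover)
  also have "\<dots> = (\<Sum>S\<in>?U ` R. int CARD('a) ^ t - 1)"
  proof (rule sum.cong[OF refl])
    fix S assume S: "S \<in> ?U ` R"
    then have "V \<inter> S = S" by (auto simp: subspace_of_def)
    then show "int (card (V \<inter> (S - {0}))) = int CARD('a) ^ t - 1"
      using card_Int_minus_zero[OF sub(1)[OF S] V] sub(2)[OF S] by simp
  qed
  also have "\<dots> = int (card R) * (int CARD('a) ^ t - 1)"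
    by (simp add: card_image[OF R(2)])
  finally have "int CARD('a) ^ n - 1 = int (card R) * (int CARD('a) ^ t - 1)"
    using card_Int_minus_zero[OF vec.subspace_UNIV V] dim_V by simp
  then have "int (card R * (CARD('a) ^ t - 1) + 1) = int (CARD('a) ^ n)"
    by (simp add: of_nat_diff Suc_le_eq)
  then have "card R * (CARD('a) ^ t - 1) + 1 = CARD('a) ^ n"
    using of_nat_eq_iff by blast
  then show ?thesis using family by auto
qed

end

text \<open>The functional is y \<mapsto> tr (\<theta> y) with the trace to \<open>gf t\<close>,
  where \<theta> is chosen to make it vanish at 1 and at \<nu>. The bound on m gives 2t < n, used
  both for \<nu> and for \<theta>.\<close>

lemma exists_frame_family_zero:
  fixes V :: "('a::{field,finite} ^ 'n::finite) set"
  assumes t: "0 < t" and m: "3 \<le> m" and V: "vec.subspace V" "vec.dim V = m * t"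
  shows "\<exists>\<F>. frame_family t V \<F> \<and> card \<F> * (CARD('a) ^ t - 1) + 1 = CARD('a) ^ vec.dim V"
proof -
  define n where "n = t * m"
  have n: "0 < n" "t dvd n" "vec.dim V = n" "2 * t < n" "0 < 2 * t"
    using t m V(2) by (auto simp: n_def)
  have lt: "CARD('a) ^ (2 * t) < CARD('a) ^ n"
    using n(4) card_field_ge_2[where 'a='a] by (intro power_strict_increasing) auto
  have card_V: "card V = card (gf n :: 'a alg_closure set)"
    using card_vec_subspace[OF V(1)] n by (simp add: card_gf)
  obtain f where f: "Vector_Spaces.linear (*s) (\<lambda>c x. to_ac c * x) f" "bij_betw f V (gf n)"
    using exists_linear_bij_betw[OF vec.vector_space_axioms ac.vector_space_axioms V(1) ac_subspace_gf finite
      finite_gf[OF n(1)] card_V] .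
  have f_lin: "f (x + y) = f x + f y" "f (c *s x) = to_ac c * f x" for x y c
    using f(1) by (simp_all add: Vector_Spaces.linear_iff)
  have "\<not> (gf n \<subseteq> (gf (2 * t) :: 'a alg_closure set))"
    using lt n card_mono[OF finite_gf[OF n(5)], of "gf n :: 'a alg_closure set"]
    by (auto simp: card_gf)
  then obtain \<nu> :: "'a alg_closure" where \<nu>: "\<nu> \<in> gf n" "\<nu> \<notin> gf (2 * t)" by blast
  let ?tr = "gf_trace t m :: 'a alg_closure \<Rightarrow> 'a alg_closure"
  have tr_diff: "?tr (a - b) = ?tr a - ?tr b" for a b
    using gf_trace_add[of t m "a - b" b] by simp
  have tr_in: "?tr y \<in> gf t" if "y \<in> gf n" for y
    using gf_trace_in_gf that by (simp add: n_def)
  \<comment> \<open>There are q^n arguments but at most q^(2t) values; the difference of two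
    colliding arguments is the wanted \<theta>.\<close>
  have "\<not> inj_on (\<lambda>\<theta>. (?tr \<theta>, ?tr (\<theta> * \<nu>))) (gf n)"
  proof
    assume inj: "inj_on (\<lambda>\<theta>. (?tr \<theta>, ?tr (\<theta> * \<nu>))) (gf n)"
    have "card (gf n :: 'a alg_closure set) \<le>
        card ((gf t :: 'a alg_closure set) \<times> (gf t :: 'a alg_closure set))"
      by (rule card_inj_on_le[OF inj]) (use t \<nu>(1) in \<open>auto intro!: tr_in gf_mult\<close>)
    then have "CARD('a) ^ n \<le> CARD('a) ^ (2 * t)"
      using t n by (simp add: card_gf card_cartesian_product mult_2 power_add)
    then show False using lt by simp
  qed
  then obtain a b where ab: "a \<in> gf n" "b \<in> gf n" "a \<noteq> b" "?tr a = ?tr b" "?tr (a * \<nu>) = ?tr (b * \<nu>)"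
    by (auto simp: inj_on_def)
  define \<theta> where "\<theta> = a - b"
  have \<theta>: "\<theta> \<in> gf n" "\<theta> \<noteq> 0" "?tr \<theta> = 0" "?tr (\<theta> * \<nu>) = 0"
    using ab by (simp_all add: \<theta>_def tr_diff gf_diff left_diff_distrib)
  obtain z where z: "z \<in> gf n" "?tr z \<noteq> 0"
    using gf_trace_nonzero[of t m] t m unfolding n_def by (metis not_numeral_le_zero gr0I)
  \<comment> \<open>A vector of nonzero trace, normalised to trace 1 and divided by \<theta> to undo
    the twist.\<close>
  define y0 where "y0 = inverse (?tr z) * z / \<theta>"
  have iz: "inverse (?tr z) \<in> gf t" using z tr_in gf_inverse by blast
  have "y0 \<in> gf n"
    using iz gf_mono[OF n(2), where 'a='a] z \<theta> by (auto simp: y0_def intro!: gf_closed)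
  moreover have "?tr (\<theta> * y0) = 1"
    using gf_trace_mult[OF iz, of m z] \<theta>(2) z(2) by (simp add: y0_def)
  moreover have "?tr (\<theta> * (a + b)) = ?tr (\<theta> * a) + ?tr (\<theta> * b)" for a b
    by (simp add: gf_trace_add distrib_left)
  moreover have "?tr (\<theta> * (k * a)) = k * ?tr (\<theta> * a)" if "k \<in> gf t" for k a
    using gf_trace_mult[OF that, of m "\<theta> * a"] by (simp add: mult.left_commute)
  moreover have "?tr (\<theta> * a) \<in> gf t" if "a \<in> gf n" for a
    using that \<theta>(1) by (intro tr_in gf_mult)
  moreover have "?tr (\<theta> * 1) = 0" using \<theta>(3) by simp
  ultimately have "field_orbit V n t f (\<lambda>y. ?tr (\<theta> * y)) \<nu> y0"
    by (intro field_orbit.intro V(1) t n f_lin f(2) \<theta>(4) \<nu>)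
  then interpret field_orbit V n t f "\<lambda>y. ?tr (\<theta> * y)" \<nu> y0 .
  show ?thesis using exists_family n(3) by simp
qed

section \<open>Flag codes\<close>

lemma exists_frame_family:
  assumes t: "0 < t" and r: "[r = CARD('n)] (mod t)" "r < t" and n: "2 * t + 2 \<le> CARD('n)"
  shows "\<exists>\<F> :: ('a::{field,finite}, 'n::finite) frame set. frame_family t UNIV \<F> \<and>
    card \<F> * (CARD('a) ^ t - 1) + CARD('a) ^ (t + r) + 1 = CARD('a) ^ CARD('n) + CARD('a) ^ t"
proof -
  let ?n = "CARD('n)" and ?V = "UNIV :: ('a ^ 'n) set"
  have "r = ?n mod t" using r by (simp add: cong_def)
  then have eq: "?n = (?n div t) * t + r" by simp
  show ?thesis
  proof (cases "r = 0")
    case True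
    \<comment> \<open>Here t divides n, and n \<ge> 2t + 2 excludes the quotients up to 2.\<close>
    have "3 \<le> ?n div t"
    proof (rule ccontr)
      assume "\<not> 3 \<le> ?n div t"
      then have "(?n div t) * t \<le> 2 * t" by (intro mult_right_mono) auto
      then show False using eq n True by linarith
    qed
    then show ?thesis
      using exists_frame_family_zero[OF t _ vec.subspace_UNIV, of "?n div t", where 'a='a and 'n='n]
        eq True by (auto simp: card_cart_basis add.assoc)
  next
    case False
    have "2 \<le> ?n div t"
      using n t by (simp add: less_eq_div_iff_mult_less_eq)
    then obtain m where m: "?n div t = m + 2"
      by (metis add.commute le_Suc_ex)
    then show ?thesis
      using exists_frame_family_pos[OF t _ vec.subspace_UNIV, of r m, where 'a='a and 'n='n] eq False
      by (auto simp: card_cart_basis)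
  qed
qed

section \<open>Completing frames to flags, and distances between them\<close>

lemma exists_subspace_between:
  fixes S T :: "('a::{field,finite} ^ 'n::finite) set"
  assumes "vec.subspace S" "vec.subspace T" "S \<subseteq> T" "vec.dim S \<le> m" "m \<le> vec.dim T"
  obtains R where "vec.subspace R" "S \<subseteq> R" "R \<subseteq> T" "vec.dim R = m"
proof -
  obtain B where B: "B \<subseteq> S" "vec.independent B" "S \<subseteq> vec.span B" "card B = vec.dim S"
    using vec.basis_exists .
  then obtain C where C: "B \<subseteq> C" "C \<subseteq> T" "vec.independent C" "T \<subseteq> vec.span C"
    using vec.maximal_independent_subset_extend[of B T] assms(3) by blast
  then have "card C = vec.dim T" using vec.basis_card_eq_dim by blast
  then obtain D where D: "B \<subseteq> D" "D \<subseteq> C" "card D = m"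
    using exists_subset_between[of B m C] B(4) C(1) assms(4,5) by auto
  show thesis
  proof
    show "S \<subseteq> vec.span D" using B(3) vec.span_mono[OF D(1)] by blast
    show "vec.span D \<subseteq> T" using D(2) C(2) assms(2) vec.span_minimal by blast
    show "vec.dim (vec.span D) = m"
      using D(3) vec.dim_span_eq_card_independent vec.independent_mono[OF C(3) D(2)] by metis
  qed simp
qed

lemma exists_chain:
  fixes S T :: "('a::{field,finite} ^ 'n::finite) set"
  assumes "vec.subspace S" "vec.subspace T" "S \<subseteq> T"
  shows "\<exists>G. G (vec.dim S) = S \<and> G (vec.dim T) = T \<and>
    (\<forall>i\<in>{vec.dim S..vec.dim T}. vec.subspace (G i) \<and> vec.dim (G i) = i \<and> S \<subseteq> G i \<and> G i \<subseteq> T) \<and>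
    (\<forall>i j. vec.dim S \<le> i \<longrightarrow> i \<le> j \<longrightarrow> j \<le> vec.dim T \<longrightarrow> G i \<subseteq> G j)"
  using assms(2,3)
proof (induction "vec.dim T - vec.dim S" arbitrary: T)
  case 0
  then have "vec.dim T \<le> vec.dim S" by simp
  then have "S = T" using vec.subspace_dim_equal[OF assms(1) 0(2,3)] by simp
  then show ?case using 0(2) by (intro exI[of _ "\<lambda>_. S"]) auto
next
  case (Suc d)
  let ?m = "vec.dim T - 1"
  have m: "vec.dim S \<le> ?m" "?m \<le> vec.dim T" "vec.dim T = Suc ?m"
    using Suc(2) by auto
  obtain R where R: "vec.subspace R" "S \<subseteq> R" "R \<subseteq> T" "vec.dim R = ?m"
    using exists_subspace_between[OF assms(1) Suc(3,4) m(1,2)] .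
  have "d = vec.dim R - vec.dim S" using Suc(2) R(4) by simp
  from Suc(1)[OF this R(1,2)] obtain G where G: "G (vec.dim S) = S" "G ?m = R"
    "\<And>i. i \<in> {vec.dim S..?m} \<Longrightarrow> vec.subspace (G i) \<and> vec.dim (G i) = i \<and> S \<subseteq> G i \<and> G i \<subseteq> R"
    "\<And>i j. vec.dim S \<le> i \<Longrightarrow> i \<le> j \<Longrightarrow> j \<le> ?m \<Longrightarrow> G i \<subseteq> G j"
    unfolding R(4) by blast
  define H where "H i = (if i \<le> ?m then G i else T)" for i
  show ?case
  proof (intro exI[of _ H] conjI ballI allI impI)
    show "H (vec.dim S) = S" "H (vec.dim T) = T" using m G(1) by (auto simp: H_def)
    fix i assume i: "i \<in> {vec.dim S..vec.dim T}"
    then show "vec.subspace (H i)" "vec.dim (H i) = i" "S \<subseteq> H i" "H i \<subseteq> T"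
      using G(3)[of i] R(3) Suc(3,4) m by (auto simp: H_def)
  next
    fix i j assume "vec.dim S \<le> i" "i \<le> j" "j \<le> vec.dim T"
    then show "H i \<subseteq> H j" using G(3)[of i] G(4)[of i j] R(3) by (auto simp: H_def)
  qed
qed

text \<open>\<open>G\<close> lists the members of a flag by dimension.\<close>
definition refines :: "nat \<Rightarrow> (nat \<Rightarrow> ('a::field ^ 'n::finite) set) \<Rightarrow> ('a, 'n) frame \<Rightarrow> bool" where
  "refines t G = (\<lambda>(U, E, W). G t = U \<and> G (Suc t) = E \<and> (\<forall>i\<le>t. G i \<subseteq> U) \<and> (\<forall>i. CARD('n) - t \<le> i \<longrightarrow> W \<subseteq> G i) \<and>
     (let I = {1..t + 1} \<union> {CARD('n) - t..CARD('n) - 1} in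
       (\<forall>i\<in>I. vec.subspace (G i) \<and> vec.dim (G i) = i) \<and> (\<forall>i\<in>I. \<forall>j\<in>I. i < j \<longrightarrow> G i \<subset> G j)))"

lemma exists_refines:
  fixes F :: "('a::{field,finite}, 'n::finite) frame"
  assumes "frame t UNIV F" "2 * t + 2 \<le> CARD('n)"
  shows "\<exists>G. refines t G F"
proof -
  let ?n = "CARD('n)"
  obtain U E W where F: "F = (U, E, W)" by (cases F)
  have *: "vec.subspace U" "vec.subspace E" "vec.subspace W" "vec.dim U = t" "vec.dim E = Suc t"
    "vec.dim W = ?n - t" "U \<subseteq> E" "E \<subseteq> W"
    using assms(1) F by (auto simp: frame_def card_cart_basis)
  obtain G1 where G1: "G1 t = U" "\<And>i. i \<le> t \<Longrightarrow> vec.subspace (G1 i) \<and> vec.dim (G1 i) = i \<and> G1 i \<subseteq> U"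
    "\<And>i j. i \<le> j \<Longrightarrow> j \<le> t \<Longrightarrow> G1 i \<subseteq> G1 j"
    using exists_chain[OF vec.subspace_single_0 *(1)] vec.subspace_0[OF *(1)] *(4) by fastforce
  obtain G2 where "G2 (vec.dim W) = W \<and> G2 ?n = UNIV \<and>
      (\<forall>i\<in>{vec.dim W..?n}. vec.subspace (G2 i) \<and> vec.dim (G2 i) = i \<and> W \<subseteq> G2 i \<and> G2 i \<subseteq> UNIV) \<and>
      (\<forall>i j. vec.dim W \<le> i \<longrightarrow> i \<le> j \<longrightarrow> j \<le> ?n \<longrightarrow> G2 i \<subseteq> G2 j)"
    using exists_chain[OF *(3) vec.subspace_UNIV subset_UNIV] unfolding vec_dim_card ..
  then have G2: "\<And>i. ?n - t \<le> i \<Longrightarrow> i \<le> ?n \<Longrightarrow> vec.subspace (G2 i) \<and> vec.dim (G2 i) = i \<and> W \<subseteq> G2 i"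
    "\<And>i j. ?n - t \<le> i \<Longrightarrow> i \<le> j \<Longrightarrow> j \<le> ?n \<Longrightarrow> G2 i \<subseteq> G2 j"
    unfolding *(6) by simp_all
  \<comment> \<open>By 2t + 2 \<le> n the index t + 1 is below n - t, so \<open>E\<close> occupies
    its place between the two chains.\<close>
  define G where "G i = (if i \<le> t then G1 i else if i < ?n - t then E else if i \<le> ?n then G2 i else UNIV)" for i
  let ?I = "{1..t + 1} \<union> {?n - t..?n - 1}"
  have sub: "vec.subspace (G i)" "vec.dim (G i) = i" if "i \<in> ?I" for i
    using that G1(2)[of i] G2(1)[of i] *(2,5) assms(2) by (auto simp: G_def le_Suc_eq)
  have mono: "G i \<subseteq> G j" if ij: "i \<in> ?I" "j \<in> ?I" "i < j" for i j
  proof -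
    consider "j \<le> t" | "i \<le> t" "t < j" "j < ?n - t" | "i \<le> t" "?n - t \<le> j" | "t < i" "i < ?n - t" "?n - t \<le> j"
      | "?n - t \<le> i"
      using ij assms(2) by fastforce
    then show ?thesis
    proof cases
      case 1 then show ?thesis using ij G1(3)[of i j] by (simp add: G_def)
    next
      case 2 then show ?thesis using ij G1(2)[of i] *(7) by (auto simp: G_def)
    next
      case 3 then show ?thesis using ij G1(2)[of i] G2(1)[of j] *(7,8) assms(2) by (auto simp: G_def)
    next
      case 4 then show ?thesis using ij G2(1)[of j] *(8) assms(2) by (auto simp: G_def)
    next
      case 5 then show ?thesis using ij G2(2)[of i j] assms(2) by (auto simp: G_def)
    qed
  qed
  have strict: "\<forall>i\<in>?I. \<forall>j\<in>?I. i < j \<longrightarrow> G i \<subset> G j"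
    using mono sub(2) by (metis less_irrefl psubsetI)
  have sub': "\<forall>i\<in>?I. vec.subspace (G i) \<and> vec.dim (G i) = i"
    using sub by simp
  have "G t = U" "G (Suc t) = E" "\<forall>i\<le>t. G i \<subseteq> U" "\<forall>i. ?n - t \<le> i \<longrightarrow> W \<subseteq> G i"
    using G1 G2(1) assms(2) by (auto simp: G_def)
  then have "refines t G F"
    unfolding refines_def F Let_def prod.case using sub' strict by (intro conjI)
  then show ?thesis by blast
qed

lemma subspace_distance_eq:
  fixes S T :: "('a::field ^ 'n::finite) set"
  assumes "vec.dim S = s" "vec.dim T = s"
  shows "subspace_distance S T + 2 * vec.dim (S \<inter> T) = 2 * s"
proof -
  have "vec.dim (S \<inter> T) \<le> s" using vec.dim_subset[of "S \<inter> T" S] assms by auto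
  then show ?thesis using assms by (simp add: subspace_distance_def)
qed

lemma subspace_distance_le:
  fixes S T :: "('a::field ^ 'n::finite) set"
  assumes "vec.subspace S" "vec.subspace T" "vec.dim S = s" "vec.dim T = s"
  shows "subspace_distance S T \<le> 2 * min s (CARD('n) - s)"
proof -
  have "vec.dim (subspace_sum S T) \<le> CARD('n)"
    using vec.dim_subset_UNIV[of "subspace_sum S T"] by (simp add: vec.dimension_def card_cart_basis)
  then show ?thesis
    using dim_subspace_sum_Int[OF assms(1,2)] subspace_distance_eq[OF assms(3,4)] assms by linarith
qed

lemma sum_nth_eq_sum_set:
  assumes "distinct ts"
  shows "(\<Sum>i<length ts. h (ts ! i)) = (\<Sum>t\<in>set ts. h t)"
  using assms by (simp add: sum.reindex_bij_betw[OF bij_betw_nth[OF assms refl refl]])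

text \<open>The threshold \<open>n div 2\<close> only decides which of t and n - t is smaller. In
  this form the maximum can be compared dimension by dimension.\<close>

lemma max_flag_distance_eq:
  "max_flag_distance n ts = (\<Sum>t\<in>set ts. 2 * min t (n - t))"
proof -
  have "set ts = {t \<in> set ts. t \<le> n div 2} \<union> {t \<in> set ts. t > n div 2}" by auto
  then have "(\<Sum>t\<in>set ts. min t (n - t)) =
      (\<Sum>t | t \<in> set ts \<and> t \<le> n div 2. min t (n - t)) + (\<Sum>t | t \<in> set ts \<and> t > n div 2. min t (n - t))"
    by (metis (no_types, lifting) sum.union_disjoint List.finite_set finite_Un disjoint_iff mem_Collect_eq not_le)
  also have "(\<Sum>t | t \<in> set ts \<and> t \<le> n div 2. min t (n - t)) = (\<Sum>t | t \<in> set ts \<and> t \<le> n div 2. t)"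
    by (rule sum.cong) auto
  also have "(\<Sum>t | t \<in> set ts \<and> t > n div 2. min t (n - t)) = (\<Sum>t | t \<in> set ts \<and> t > n div 2. n - t)"
    by (rule sum.cong) auto
  finally show ?thesis by (simp add: max_flag_distance_def flip: sum_distrib_left)
qed

text \<open>\<open>U'\<close> is a hyperplane of \<open>E'\<close>, and a subspace of
  \<open>E'\<close> that meets a hyperplane trivially has dimension at most 1.\<close>

lemma dim_Int_le_1:
  fixes E U' E' :: "('a::field ^ 'n::finite) set"
  assumes "vec.subspace E" "vec.subspace E'" "vec.subspace U'" "U' \<subseteq> E'" "vec.dim E' = Suc (vec.dim U')"
    and "E \<inter> U' \<subseteq> {0}"
  shows "vec.dim (E \<inter> E') \<le> 1"
proof -
  have sub: "vec.subspace (E \<inter> E')" using assms by (simp add: vec.subspace_inter)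
  have "vec.dim (E \<inter> E') + vec.dim U' = vec.dim (subspace_sum (E \<inter> E') U')"
    using assms by (subst dim_subspace_sum[OF sub]) auto
  also have "\<dots> \<le> vec.dim E'"
    using assms by (intro vec.dim_subset subspace_sum_subset) auto
  finally show ?thesis using assms(5) by simp
qed

context
  fixes t :: nat and ts :: "nat list"
  assumes t: "0 < t" and n: "2 * t + 2 \<le> CARD('n::finite)"
  defines "ts \<equiv> sorted_list_of_set ({1..t + 1} \<union> {CARD('n) - t..CARD('n) - 1})"
begin

lemma set_ts: "set ts = {1..t + 1} \<union> {CARD('n) - t..CARD('n) - 1}"
  and distinct_ts: "distinct ts" and sorted_ts: "sorted_wrt (<) ts"
  by (simp_all add: ts_def)

lemma flag_type_ts: "flag_type CARD('n) ts"
proof -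
  have "ts \<noteq> []" using set_ts by force
  then show ?thesis using sorted_ts n set_ts t by (auto simp: flag_type_def)
qed

lemma is_flag_refines:
  fixes G :: "nat \<Rightarrow> ('a::field ^ 'n) set"
  assumes "refines t G F"
  shows "is_flag ts (map G ts)"
proof -
  have G: "\<And>i. i \<in> set ts \<Longrightarrow> vec.subspace (G i) \<and> vec.dim (G i) = i"
    "\<And>i j. i \<in> set ts \<Longrightarrow> j \<in> set ts \<Longrightarrow> i < j \<Longrightarrow> G i \<subset> G j"
    using assms unfolding refines_def set_ts by (auto simp: Let_def split: prod.splits)
  have "sorted_wrt (\<lambda>i j. G i \<subset> G j) ts"
    using sorted_ts G(2) by (rule sorted_wrt_mono_rel[rotated]) auto
  then show ?thesis
    using G(1) by (auto simp: is_flag_def sorted_wrt_map)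
qed

text \<open>Members of dimension up to t lie in U and U', which meet trivially; members of dimension
  at least n - t contain W and W', which span the space. Both attain the maximum, so only dimension
  t + 1 can lose, namely 2 per dimension of the intersection.\<close>

lemma flag_distance_refines:
  fixes G G' :: "nat \<Rightarrow> ('a::{field,finite} ^ 'n) set"
  assumes G: "refines t G (U, E, W)" "refines t G' (U', E', W')"
    and fr: "frame t UNIV (U, E, W)" "frame t UNIV (U', E', W')"
    and comp: "compatible UNIV (U, E, W) (U', E', W')"
  shows "flag_distance (map G ts) (map G' ts) + 2 * vec.dim (E \<inter> E') = max_flag_distance CARD('n) ts"
proof -
  let ?n = "CARD('n)" and ?d = "\<lambda>i. subspace_distance (G i) (G' i)"
  have dims: "vec.subspace (G i)" "vec.dim (G i) = i" "vec.subspace (G' i)" "vec.dim (G' i) = i" if "i \<in> set ts" for i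
    using G that unfolding refines_def set_ts by (auto simp: Let_def)
  have E: "G (Suc t) = E" "G' (Suc t) = E'" using G by (auto simp: refines_def)
  have d: "?d i + (if i = Suc t then 2 * vec.dim (E \<inter> E') else 0) = 2 * min i (?n - i)" if i: "i \<in> set ts" for i
  proof -
    consider "1 \<le> i" "i \<le> t" | "i = Suc t" | "?n - t \<le> i" "i \<le> ?n - 1" using i set_ts by fastforce
    then show ?thesis
    proof cases
      case 1
      have "G i \<inter> G' i \<subseteq> U \<inter> U'" using G 1 by (auto simp: refines_def)
      moreover have "U \<inter> U' \<subseteq> {0}" using fr comp unfolding frame_def compatible_def by blast
      ultimately have d0: "vec.dim (G i \<inter> G' i) = 0" using vec.dim_eq_0 by (metis subset_trans)
      show ?thesis
        using subspace_distance_eq[OF dims(2,4)[OF i]] 1 n unfolding d0 by (simp add: min_def)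
    next
      case 2
      then show ?thesis using subspace_distance_eq[OF dims(2,4)[OF i]] n E by (simp add: min_def)
    next
      case 3
      have "W \<subseteq> G i" "W' \<subseteq> G' i" using G 3 by (auto simp: refines_def)
      then have "subspace_sum (G i) (G' i) = UNIV"
        using comp subspace_sum_mono[of W "G i" W' "G' i"] unfolding compatible_def by blast
      then have "?n + vec.dim (G i \<inter> G' i) = i + i"
        using dim_subspace_sum_Int[OF dims(1,3)[OF i]] dims[OF i] by (simp add: card_cart_basis)
      moreover have "i \<noteq> Suc t" "min i (?n - i) = ?n - i" "i \<le> ?n" using 3 n by auto
      ultimately show ?thesis using subspace_distance_eq[OF dims(2,4)[OF i]] by simp
    qed
  qed
  have "flag_distance (map G ts) (map G' ts) = (\<Sum>i\<in>set ts. ?d i)"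
    using sum_nth_eq_sum_set[OF distinct_ts, of ?d] by (simp add: flag_distance_def)
  moreover have "(\<Sum>i\<in>set ts. if i = Suc t then 2 * vec.dim (E \<inter> E') else 0) = 2 * vec.dim (E \<inter> E')"
    by (simp add: sum.delta' set_ts)
  moreover have "(\<Sum>i\<in>set ts. ?d i + (if i = Suc t then 2 * vec.dim (E \<inter> E') else 0)) =
      (\<Sum>i\<in>set ts. 2 * min i (?n - i))"
    by (rule sum.cong[OF refl d])
  ultimately show ?thesis
    unfolding max_flag_distance_eq by (simp only: sum.distrib)
qed

lemma finite_flags: "finite {F :: ('a::{field,finite} ^ 'n) set list. is_flag ts F}"
  by (rule finite_subset[OF _ finite_lists_length_eq[of UNIV "length ts"]]) (auto simp: is_flag_def)

lemma finite_code:
  fixes C :: "('a::{field,finite} ^ 'n) set list set"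
  assumes "\<forall>F\<in>C. is_flag ts F"
  shows "finite C" "finite {flag_distance F G | F G. F \<in> C \<and> G \<in> C \<and> F \<noteq> G}"
proof -
  show C: "finite C" by (rule finite_subset[OF _ finite_flags]) (use assms in auto)
  show "finite {flag_distance F G | F G. F \<in> C \<and> G \<in> C \<and> F \<noteq> G}"
    by (rule finite_subset[of _ "(\<lambda>(F, G). flag_distance F G) ` (C \<times> C)"]) (auto simp: C)
qed

section \<open>Upper bound for almost optimum distance flag codes\<close>

lemma card_aodfc_le:
  fixes C :: "('a::{field,finite} ^ 'n) set list set"
  assumes C: "aodfc ts C"
    and \<theta>: "\<theta> < t" "\<theta> * (CARD('a) - 1) + 1 = CARD('a) ^ r"
    and M: "M * (CARD('a) ^ t - 1) + CARD('a) ^ (t + r) + 1 = CARD('a) ^ CARD('n) + CARD('a) ^ t"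
  shows "card C \<le> M"
proof -
  let ?n = "CARD('n)"
  have flags: "is_flag ts F" if "F \<in> C" for F
    using C that by (simp add: aodfc_def flag_code_def)
  obtain i0 i1 where i: "i0 < length ts" "ts ! i0 = t" "i1 < length ts" "ts ! i1 = Suc t"
    using set_ts t by (metis UnI1 add.commute atLeastAtMost_iff in_set_conv_nth le_add2 le_refl
        less_eq_Suc_le One_nat_def plus_1_eq_Suc)
  have "i0 < i1"
    using i sorted_wrt_nth_less[OF sorted_ts, of i1 i0] by (metis Suc_n_not_le_n less_Suc_eq linorder_neqE_nat not_less_eq)
  have disj: "F ! i0 \<inter> G ! i0 \<subseteq> {0}" if FG: "F \<in> C" "G \<in> C" "F \<noteq> G" for F G
  proof (rule ccontr)
    assume "\<not> ?thesis"
    then have d0: "vec.dim (F ! i0 \<inter> G ! i0) \<ge> 1"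
      using vec.dim_eq_0 by (metis One_nat_def Suc_leI neq0_conv)
    have F: "length F = length ts" "sorted_wrt (\<subset>) F" "sorted_wrt (\<subset>) G" "length G = length ts"
      and dims: "vec.subspace (F ! j)" "vec.dim (F ! j) = ts ! j" "vec.subspace (G ! j)" "vec.dim (G ! j) = ts ! j"
      if "j < length ts" for j
      using flags[OF FG(1)] flags[OF FG(2)] that by (auto simp: is_flag_def)
    have "F ! i0 \<subseteq> F ! i1" "G ! i0 \<subseteq> G ! i1"
      using sorted_wrt_nth_less[OF _ \<open>i0 < i1\<close>] F[OF i(1)] i(3) by fastforce+
    then have d1: "vec.dim (F ! i1 \<inter> G ! i1) \<ge> 1"
      using d0 vec.dim_subset[of "F ! i0 \<inter> G ! i0" "F ! i1 \<inter> G ! i1"] by (meson Int_mono order_trans)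
    let ?d = "\<lambda>j. subspace_distance (F ! j) (G ! j)"
    \<comment> \<open>As t + 1 \<le> n - (t + 1), the maximal distance at both positions is twice
      the dimension, so a nontrivial intersection costs at least 2 at each.\<close>
    have "(\<Sum>j<length ts. ?d j + (if j = i0 then 2 else 0) + (if j = i1 then 2 else 0))
        \<le> (\<Sum>j<length ts. 2 * min (ts ! j) (?n - ts ! j))"
    proof (rule sum_mono)
      fix j assume "j \<in> {..<length ts}"
      then have j: "j < length ts" by simp
      consider "j = i0" | "j = i1" | "j \<noteq> i0" "j \<noteq> i1" by blast
      then show "?d j + (if j = i0 then 2 else 0) + (if j = i1 then 2 else 0) \<le> 2 * min (ts ! j) (?n - ts ! j)"
      proof cases
        case 1
        then show ?thesis
          using subspace_distance_eq[OF dims(2,4)[OF j]] d0 i n \<open>i0 < i1\<close> by (simp add: min_def)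
      next
        case 2
        then show ?thesis
          using subspace_distance_eq[OF dims(2,4)[OF j]] d1 i n \<open>i0 < i1\<close> by (simp add: min_def)
      next
        case 3
        then show ?thesis
          using subspace_distance_le[OF dims(1,3,2,4)[OF j]] by simp
      qed
    qed
    also have "\<dots> = max_flag_distance ?n ts"
      unfolding max_flag_distance_eq by (rule sum_nth_eq_sum_set[OF distinct_ts])
    finally have "flag_distance F G + 4 \<le> max_flag_distance ?n ts"
      using i(1,3) F[OF i(1)] by (simp add: flag_distance_def sum.distrib)
    moreover have "code_distance C \<le> flag_distance F G"
      unfolding code_distance_def using finite_code(2)[of C] flags FG by (intro Min_le) auto
    moreover have "code_distance C + 2 = max_flag_distance ?n ts"
      using C by (simp add: aodfc_def)
    ultimately show False by simp
  qed
  have sub: "vec.subspace (F ! i0)" "vec.dim (F ! i0) = t" if "F \<in> C" for F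
    using flags[OF that] i by (auto simp: is_flag_def)
  have "inj_on (\<lambda>F. F ! i0) C"
  proof (rule inj_onI, rule ccontr)
    fix F G assume FG: "F \<in> C" "G \<in> C" "F ! i0 = G ! i0" "F \<noteq> G"
    then have "F ! i0 \<subseteq> {0}" using disj[OF FG(1,2,4)] by simp
    then show False using sub(2)[OF FG(1)] t vec.dim_eq_0 by (metis less_irrefl)
  qed
  then have "card C = card ((\<lambda>F. F ! i0) ` C)" by (simp add: card_image)
  also have "\<dots> \<le> M"
  proof (rule partial_spread_card_le[OF _ _ _ \<theta> M])
    show "pairwise (\<lambda>U W. U \<inter> W \<subseteq> {0}) ((\<lambda>F. F ! i0) ` C)"
      by (rule pairwise_imageI) (rule disj)
  qed (use sub in auto)
  finally show ?thesis .
qed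

section \<open>Attaining the bound with the prescribed distance\<close>

lemma exists_meeting_pair:
  fixes \<F> :: "('a::{field,finite}, 'n) frame set"
  assumes family: "frame_family t UNIV \<F>" and r: "r < t"
    and card: "card \<F> * (CARD('a) ^ t - 1) + CARD('a) ^ (t + r) + 1 = CARD('a) ^ CARD('n) + CARD('a) ^ t"
  obtains U E W U' E' W' where "(U, E, W) \<in> \<F>" "(U', E', W') \<in> \<F>" "(U, E, W) \<noteq> (U', E', W')"
    "vec.dim (E \<inter> E') \<noteq> 0"
proof (rule ccontr)
  assume none: "\<not> thesis"
  note found = that
  let ?E = "\<lambda>F :: ('a, 'n) frame. fst (snd F)"
  define q N M where "q = int CARD('a)" and "N = CARD('n)" and "M = int (card \<F>)"
  have q2: "q \<ge> 2" using card_field_ge_2[where 'a='a] by (simp add: q_def)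
  have fr: "vec.subspace (?E F)" "vec.dim (?E F) = Suc t" if "F \<in> \<F>" for F
    using family that by (auto simp: frame_family_def frame_def)
  have disj: "?E F \<inter> ?E G \<subseteq> {0}" if "F \<in> \<F>" "G \<in> \<F>" "F \<noteq> G" for F G
  proof -
    obtain U E W U' E' W' where eq: "F = (U, E, W)" "G = (U', E', W')" by (cases F, cases G)
    then have "vec.dim (E \<inter> E') = 0" using none found that by blast
    then show ?thesis using eq vec.dim_eq_0 by auto
  qed
  have "inj_on ?E \<F>"
  proof (rule inj_onI, rule ccontr)
    fix F G assume FG: "F \<in> \<F>" "G \<in> \<F>" "?E F = ?E G" "F \<noteq> G"
    then have "?E F \<subseteq> {0}" using disj[OF FG(1,2,4)] by simp
    then show False using fr(2)[OF FG(1)] vec.dim_eq_0 by (metis nat.distinct(1))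
  qed
  then have card_E: "card (?E ` \<F>) = card \<F>" by (rule card_image)
  have "pairwise (\<lambda>S T. S \<inter> T \<subseteq> {0}) (?E ` \<F>)"
    by (rule pairwise_imageI) (rule disj)
  then have "int (card (UNIV \<inter> (\<Union>(?E ` \<F>) - {0}))) = (\<Sum>S\<in>?E ` \<F>. int (card (UNIV \<inter> (S - {0}))))"
    using fr(1) by (intro card_nonzero_Union) auto
  also have "\<dots> = (\<Sum>S\<in>?E ` \<F>. q ^ Suc t - 1)"
  proof (rule sum.cong[OF refl])
    fix S assume "S \<in> ?E ` \<F>"
    then have "vec.subspace S" "vec.dim S = Suc t" using fr by auto
    then show "int (card (UNIV \<inter> (S - {0}))) = q ^ Suc t - 1"
      using card_Int_minus_zero[OF _ vec.subspace_UNIV, of S] by (simp add: q_def)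
  qed
  also have "\<dots> = M * (q ^ Suc t - 1)" by (simp add: card_E M_def)
  finally have "M * (q ^ Suc t - 1) = int (card (UNIV \<inter> (\<Union>(?E ` \<F>) - {0})))" by simp
  also have "\<dots> \<le> int (card (UNIV \<inter> (UNIV - {0} :: ('a ^ 'n) set)))"
    by (intro of_nat_mono card_mono) auto
  also have "\<dots> = q ^ N - 1"
    using card_Int_minus_zero[OF vec.subspace_UNIV vec.subspace_UNIV, where 'a='a and 'n='n]
    by (simp only: Int_UNIV_left vec_dim_card q_def N_def)
  finally have le: "M * (q ^ Suc t - 1) \<le> q ^ N - 1" .
  have eq: "M * (q ^ t - 1) = q ^ N + q ^ t - q ^ (t + r) - 1"
    using arg_cong[OF card, of int] by (simp add: q_def N_def M_def of_nat_diff)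
  \<comment> \<open>Passing from t to t + 1 multiplies the number of covered nonzero vectors by at
    least q. The result exceeds q^n - 1, because q^(t+r+1) \<le> q^n by r < t.\<close>
  have "M * (q ^ Suc t - 1) = q * (M * (q ^ t - 1)) + M * (q - 1)"
    by (simp add: algebra_simps)
  also have "\<dots> \<ge> q * (M * (q ^ t - 1))"
    using q2 by (simp add: M_def)
  finally have "q * (q ^ N + q ^ t - q ^ (t + r) - 1) \<le> q ^ N - 1"
    using le unfolding eq by linarith
  then have "q * q ^ N + q * q ^ t + 1 \<le> q ^ N + q ^ Suc (t + r) + q"
    by (simp add: algebra_simps)
  moreover have "2 * q ^ N \<le> q * q ^ N" using q2 by (intro mult_right_mono) auto
  moreover have "q * 1 \<le> q * q ^ t" using q2 by (intro mult_left_mono) auto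
  moreover have "q ^ Suc (t + r) \<le> q ^ N" using q2 r n by (intro power_increasing) (auto simp: N_def)
  ultimately show False by linarith
qed

text \<open>Compatibility bounds the loss of every pair by 2, and a meeting pair loses exactly 2, so
  the minimum distance is neither larger nor smaller than required.\<close>

lemma exists_aodfc:
  fixes \<F> :: "('a::{field,finite}, 'n) frame set"
  assumes family: "frame_family t UNIV \<F>" and r: "r < t"
    and card: "card \<F> * (CARD('a) ^ t - 1) + CARD('a) ^ (t + r) + 1 = CARD('a) ^ CARD('n) + CARD('a) ^ t"
  shows "\<exists>C :: ('a ^ 'n) set list set. aodfc ts C \<and> card C = card \<F>"
proof -
  have fr: "frame t UNIV F" if "F \<in> \<F>" for F
    using family that by (simp add: frame_family_def)
  have comp: "compatible UNIV F F'" if "F \<in> \<F>" "F' \<in> \<F>" "F \<noteq> F'" for F F'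
    using family that by (simp add: frame_family_def pairwise_def)
  obtain G where G: "\<And>F. F \<in> \<F> \<Longrightarrow> refines t (G F) F"
    using exists_refines[OF fr n] by metis
  let ?L = "\<lambda>F. map (G F) ts"
  have dist: "flag_distance (?L (U, E, W)) (?L (U', E', W')) + 2 * vec.dim (E \<inter> E') = max_flag_distance CARD('n) ts"
    if "(U, E, W) \<in> \<F>" "(U', E', W') \<in> \<F>" "(U, E, W) \<noteq> (U', E', W')" for U E W U' E' W'
    using flag_distance_refines[OF G[OF that(1)] G[OF that(2)] fr[OF that(1)] fr[OF that(2)] comp[OF that]] .
  have inj: "inj_on ?L \<F>"
  proof (rule inj_onI, rule ccontr)
    fix F F' assume F: "F \<in> \<F>" "F' \<in> \<F>" "?L F = ?L F'" "F \<noteq> F'"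
    obtain U E W U' E' W' where eq: "F = (U, E, W)" "F' = (U', E', W')" by (cases F, cases F')
    have "t \<in> set ts" using set_ts t by auto
    then have "U = U'" using F(3) G[OF F(1)] G[OF F(2)] unfolding eq by (auto simp: refines_def)
    then have "U \<subseteq> {0}" "vec.dim U = t"
      using fr[OF F(1)] fr[OF F(2)] comp[OF F(1,2,4)] unfolding eq frame_def compatible_def by blast+
    then show False using t vec.dim_eq_0 by (metis less_irrefl)
  qed
  define C where "C = ?L ` \<F>"
  have flags: "\<forall>L\<in>C. is_flag ts L"
  proof
    fix L assume "L \<in> C"
    then obtain F where "F \<in> \<F>" "L = ?L F" unfolding C_def by blast
    then show "is_flag ts L" using is_flag_refines[OF G] by simp
  qed
  obtain U E W U' E' W' where pair: "(U, E, W) \<in> \<F>" "(U', E', W') \<in> \<F>" "(U, E, W) \<noteq> (U', E', W')"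
    "vec.dim (E \<inter> E') \<noteq> 0"
    using exists_meeting_pair[OF family r card] .
  have le_1: "vec.dim (E \<inter> E') \<le> 1"
    if "(U, E, W) \<in> \<F>" "(U', E', W') \<in> \<F>" "(U, E, W) \<noteq> (U', E', W')" for U E W U' E' W'
  proof -
    have "E \<inter> U' \<subseteq> {0} \<or> E' \<inter> U \<subseteq> {0}"
      using comp[OF that] by (simp add: compatible_def)
    then show ?thesis
      using dim_Int_le_1[of E E' U'] dim_Int_le_1[of E' E U] fr[OF that(1)] fr[OF that(2)]
      by (auto simp: frame_def Int_commute)
  qed
  have ne: "?L (U, E, W) \<noteq> ?L (U', E', W')"
    using inj pair(1-3) unfolding inj_on_def by blast
  have d1: "flag_distance (?L (U, E, W)) (?L (U', E', W')) + 2 = max_flag_distance CARD('n) ts"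
    using dist[OF pair(1-3)] le_1[OF pair(1-3)] pair(4) by linarith
  have "code_distance C = flag_distance (?L (U, E, W)) (?L (U', E', W'))"
    unfolding code_distance_def
  proof (rule Min_eqI[OF finite_code(2)[OF flags]])
    fix d assume "d \<in> {flag_distance F G | F G. F \<in> C \<and> G \<in> C \<and> F \<noteq> G}"
    then obtain F F' where F: "d = flag_distance (?L F) (?L F')" "F \<in> \<F>" "F' \<in> \<F>" "F \<noteq> F'"
      unfolding C_def by blast
    obtain U1 E1 W1 U2 E2 W2 where eq: "F = (U1, E1, W1)" "F' = (U2, E2, W2)" by (cases F, cases F')
    show "flag_distance (?L (U, E, W)) (?L (U', E', W')) \<le> d"
      using dist[OF F(2-4)[unfolded eq]] le_1[OF F(2-4)[unfolded eq]] d1 unfolding F(1) eq by simp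
  next
    show "flag_distance (?L (U, E, W)) (?L (U', E', W')) \<in> {flag_distance F G | F G. F \<in> C \<and> G \<in> C \<and> F \<noteq> G}"
      using pair ne unfolding C_def by blast
  qed
  then have "aodfc ts C"
    using d1 flags pair ne flag_type_ts unfolding aodfc_def flag_code_def C_def by auto
  moreover have "card C = card \<F>" unfolding C_def using inj by (rule card_image)
  ultimately show ?thesis by blast
qed

end

theorem corollary4p5:
  fixes q n k r :: nat
  assumes q: "q = CARD('a::{field,finite})"
    and n: "n = CARD('n::finite)"
    and k: "k \<ge> 2"
    and nk: "n \<ge> 2 * k"
    and r: "[r = n] (mod (k - 1))" "r < k - 1"
    and large: "real k > (real q ^ r - 1) / (real q - 1) + 1"
  shows "real (max_aodfc_size TYPE('a) TYPE('n) ({1..k} \<union> {n - k + 1..n - 1})) =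
           (real q ^ n - real q ^ (k + r - 1)) / (real q ^ (k - 1) - 1) + 1"
proof -
  define t where "t = k - 1"
  have t: "0 < t" "k = t + 1" "2 * t + 2 \<le> CARD('n)" "r < t" "[r = CARD('n)] (mod t)"
    using k nk r n by (auto simp: t_def)
  define ts where "ts = sorted_list_of_set ({1..t + 1} \<union> {CARD('n) - t..CARD('n) - 1})"
  have T: "{1..k} \<union> {n - k + 1..n - 1} = {1..t + 1} \<union> {CARD('n) - t..CARD('n) - 1}"
    using t n by auto
  have q2: "2 \<le> q" using card_field_ge_2[where 'a='a] by (simp add: q)
  obtain \<F> :: "('a, 'n) frame set" where \<F>: "frame_family t UNIV \<F>"
    "card \<F> * (CARD('a) ^ t - 1) + CARD('a) ^ (t + r) + 1 = CARD('a) ^ CARD('n) + CARD('a) ^ t"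
    using exists_frame_family[OF t(1,5,4,3), where 'a='a] by blast
  \<comment> \<open>The quotient (q^r - 1) / (q - 1) as a natural number; with k = t + 1 the last
    hypothesis becomes \<theta> < t.\<close>
  define \<theta> where "\<theta> = (\<Sum>i<r. q ^ i)"
  have \<theta>: "\<theta> * (q - 1) + 1 = q ^ r"
  proof -
    obtain p where "q = Suc p" using q2 by (cases q) auto
    then show ?thesis
      unfolding \<theta>_def by (induction r) (simp_all add: algebra_simps)
  qed
  have "real \<theta> = (real q ^ r - 1) / (real q - 1)"
    using arg_cong[OF \<theta>, of real] q2 by (simp add: field_simps of_nat_diff)
  then have "\<theta> < t" using large t(2) by simp
  have max: "max_aodfc_size TYPE('a) TYPE('n) ({1..k} \<union> {n - k + 1..n - 1}) = card \<F>"
    unfolding max_aodfc_size_def T ts_def[symmetric]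
  proof (rule Max_eqI)
    have le: "card C \<le> card \<F>" if "aodfc ts C" for C :: "('a ^ 'n) set list set"
      using card_aodfc_le[OF t(1,3) that[unfolded ts_def] \<open>\<theta> < t\<close> \<theta>[unfolded q] \<F>(2)] .
    then show "finite {card C | C :: ('a ^ 'n) set list set. aodfc ts C}"
      unfolding finite_nat_set_iff_bounded_le by blast
    show "d \<le> card \<F>" if "d \<in> {card C | C :: ('a ^ 'n) set list set. aodfc ts C}" for d
      using that le by blast
    show "card \<F> \<in> {card C | C :: ('a ^ 'n) set list set. aodfc ts C}"
      using exists_aodfc[OF t(1,3) \<F>(1) t(4) \<F>(2), folded ts_def] unfolding mem_Collect_eq by metis
  qed
  have "real (card \<F>) * (real q ^ t - 1) + real q ^ (t + r) + 1 = real q ^ n + real q ^ t"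
    using arg_cong[OF \<F>(2), of real] by (simp add: q n of_nat_diff)
  moreover have "real q ^ t > 1"
    using q2 t(1) by (intro one_less_power) auto
  ultimately show ?thesis
    unfolding max using t(2) by (simp add: field_simps)
qed

end
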